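(* Let $\mathcal{Y}=\mathbb{R}^m$, $m\ge1$. Let $(X_n)_{n\in\mathbb{N}}$ be a Markov chain in a random environment $(Y_n)_{n\in\mathbb{N}}$ with parametric kernel $Q$, and let $\Phi:\mathcal{X}\to\mathbb{R}$ be measurable, such that $Q$ and $\Phi$ satisfy assumption (CR) of the context with reference measure $\nu$. Suppose that $X_0$ is a random initial state independent of $\sigma(Y_n,\varepsilon_{n+1}\mid n\in\mathbb{N})$ whose law is absolutely continuous with respect to $\nu$. Then for the partial sum $S_n=\Phi(X_1)+\dots+\Phi(X_n)$, $$\mathrm{Var}(S_n)\ge\sum_{k=0}^{n-1}\mathbb{E}\left[\frac{1}{r(I_k)}\left\lVert\partial_{y_k}\mathbb{E}[S_n\mid\underline{Y}]\right\rVert^2\right],\qquad n\ge1,$$ where $\underline{Y}=(Y_0,\dots,Y_{n-1})$ and $r(I_k)$ is the spectral radius of the Fisher information matrix $$I_k:=\mathbb{E}\left[\left(\partial_y\log p_y(X_{k+1}\mid X_k)\right)^\top\left(\partial_y\log p_y(X_{k+1}\mid X_k)\right)\,\middle|\,\underline{Y}\right]\quad\text{(the derivative taken at }y=Y_k).$$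
   Context: $\mathbb{N}=\{0,1,2,\dots\}$. $\mathcal{X}$ is a complete separable metric space. A Markov chain in a random environment $(Y_n)_{n\in\mathbb{N}}$ ($\mathcal{Y}$-valued, not necessarily stationary) is given by $X_{n+1}=f(X_n,Y_n,\varepsilon_{n+1})$, with $f:\mathcal{X}\times\mathcal{Y}\times[0,1]\to\mathcal{X}$ measurable and $(\varepsilon_n)_{n\ge1}$ i.i.d. uniform on $[0,1]$, independent of the environment; its parametric kernel is $Q(y,x,B)=\int_{[0,1]}\mathbf{1}_{\{f(x,y,u)\in B\}}\,du$. $\partial_{y}$ denotes the derivative (a row vector) with respect to $y\in\mathbb{R}^m$; $\partial_{y_k}\mathbb{E}[S_n\mid\underline{Y}]$ is the derivative with respect to $y_k$ of the function $\underline{y}=(y_0,\dots,y_{n-1})\mapsto\mathbb{E}[S_n\mid\underline{Y}=\underline{y}]$ (computed from the kernels $Q(y_{k},\cdot,\cdot)$ and the law of $X_0$), evaluated at $\underline{y}=\underline{Y}$. Assumption (CR): there is a reference Borel measure $\nu$ on $\mathcal{B}(\mathcal{X})$ such that $Q(y,x,\cdot)\ll\nu$ for all $(y,x)\in\mathcal{Y}\times\mathcal{X}$, and the parametric family of conditional densities $y\mapsto p_y(z\mid x)=\frac{dQ(y,x,\cdot)}{d\nu}(z)$, $(x,z)\in\mathcal{X}\times\mathcal{X}$, together with $\Phi$ (as estimator) satisfies the regularity conditions required for the Cramér–Rao inequality. That is, for each $n\ge1$, the statistical model with parameter $\underline{y}\in\mathcal{Y}^n$ and density $p(\underline{x}\mid\underline{y})=\pi(x_0)\prod_{k=1}^np_{y_{k-1}}(x_k\mid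 x_{k-1})$ with respect to $\nu^{\otimes(n+1)}$, where $\pi=d\mathrm{Law}(X_0)/d\nu$, is differentiable in $\underline{y}$, has finite and invertible Fisher information matrix, the estimator $(\Phi(x_1),\dots,\Phi(x_n))$ has finite second moments, and differentiation in $\underline{y}$ may be interchanged with integration of $p(\underline{x}\mid\underline{y})$ and of $\Phi(x_k)p(\underline{x}\mid\underline{y})$, so that the matrix Cramér–Rao inequality is applicable.
   Formalization: (CR) additionally requires that differentiation in y may be interchanged with the inner integral over x_n (the conditional densities p_y(·|x)), for a.e. x_0,…,x_{n-1}; with interchange only for the full integral of p(x|y), scores of different steps can correlate and the bound can fail. *)

theory Defs
  imports "HOL-Probability.Probability"
begin

section \<open>Markov chains in random environments\<close>

abbreviation unit_uniform :: "real measure" where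
  "unit_uniform \<equiv> restrict_space lborel {0..1}"

text \<open>
  The noise variables are \<open>eps 1, eps 2, \<dots>\<close>; \<open>eps 0\<close> is never used. Nothing is said here about the
  dependence of the initial state \<open>X 0\<close> on the environment and on the noise.
\<close>

locale random_environment_chain = prob_space M
  for M :: "'w measure" +
  fixes f :: "'x::polish_space \<Rightarrow> 'y::topological_space \<Rightarrow> real \<Rightarrow> 'x"
    and Y :: "nat \<Rightarrow> 'w \<Rightarrow> 'y"
    and eps :: "nat \<Rightarrow> 'w \<Rightarrow> real"
    and X :: "nat \<Rightarrow> 'w \<Rightarrow> 'x"
  assumes f_measurable:
      "(\<lambda>(x, y, u). f x y u) \<in> borel \<Otimes>\<^sub>M borel \<Otimes>\<^sub>M unit_uniform \<rightarrow>\<^sub>M borel"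
    and Y_measurable: "\<And>n. Y n \<in> M \<rightarrow>\<^sub>M borel"
    and eps_measurable: "\<And>n. eps (Suc n) \<in> M \<rightarrow>\<^sub>M unit_uniform"
    and eps_uniform: "\<And>n. distr M unit_uniform (eps (Suc n)) = unit_uniform"
    and eps_indep: "indep_vars (\<lambda>_. unit_uniform) (\<lambda>n. eps (Suc n)) UNIV"
    and eps_indep_environment:
      "indep_set
         (sets (vimage_algebra (space M) (\<lambda>\<omega> n. Y n \<omega>) (PiM UNIV (\<lambda>_. borel))))
         (sets (vimage_algebra (space M) (\<lambda>\<omega> n. eps (Suc n) \<omega>) (PiM UNIV (\<lambda>_. unit_uniform))))"
    and X_initial: "X 0 \<in> M \<rightarrow>\<^sub>M borel"
    and X_step: "\<And>n \<omega>. \<omega> \<in> space M \<Longrightarrow> X (Suc n) \<omega> = f (X n \<omega>) (Y n \<omega>) (eps (Suc n) \<omega>)"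

definition param_kernel ::
    "('x::polish_space \<Rightarrow> 'y \<Rightarrow> real \<Rightarrow> 'x) \<Rightarrow> 'y \<Rightarrow> 'x \<Rightarrow> 'x measure" where
  "param_kernel f y x = distr unit_uniform borel (\<lambda>u. f x y u)"

text \<open>
  Law of \<open>(X\<^sub>0, \<dots>, X\<^sub>n)\<close> when the environment is frozen at \<open>y\<close>: initial law \<open>\<mu>0\<close>, and transition
  kernel \<open>Q (y k)\<close> from time \<open>k\<close> to time \<open>k + 1\<close>. Only \<open>y 0, \<dots>, y (n - 1)\<close> matter.
\<close>

definition frozen_law ::
    "('y \<Rightarrow> 'x::polish_space \<Rightarrow> 'x measure) \<Rightarrow> 'x measure \<Rightarrow> nat \<Rightarrow> (nat \<Rightarrow> 'y) \<Rightarrow> (nat \<Rightarrow> 'x) measure"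
where
  "frozen_law Q \<mu>0 n y =
     Ionescu_Tulcea.C (\<lambda>i x. case i of 0 \<Rightarrow> \<mu>0 | Suc k \<Rightarrow> Q (y k) (x k)) (\<lambda>_. borel)
       0 (Suc n) (\<lambda>_. undefined)"

text \<open>The function \<open>(y\<^sub>0, \<dots>, y\<^sub>n\<^sub>-\<^sub>1) \<mapsto> E[S\<^sub>n | Y\<^sub>0 = y\<^sub>0, \<dots>, Y\<^sub>n\<^sub>-\<^sub>1 = y\<^sub>n\<^sub>-\<^sub>1]\<close>.\<close>

definition frozen_mean_sum ::
    "('y \<Rightarrow> 'x::polish_space \<Rightarrow> 'x measure) \<Rightarrow> 'x measure \<Rightarrow> ('x \<Rightarrow> real) \<Rightarrow> nat \<Rightarrow> (nat \<Rightarrow> 'y) \<Rightarrow> real"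
where
  "frozen_mean_sum Q \<mu>0 \<Phi> n y = (\<integral>x. (\<Sum>k=1..n. \<Phi> (x k)) \<partial>frozen_law Q \<mu>0 n y)"


section \<open>Gradients, matrices, variance\<close>

definition gradient :: "('a::real_inner \<Rightarrow> real) \<Rightarrow> 'a \<Rightarrow> 'a" where
  "gradient g v = (THE D. GDERIV g v :> D)"

lemma gradient_eq: "GDERIV g v :> D \<Longrightarrow> gradient g v = D"
  unfolding gradient_def
proof (rule the_equality)
  fix D' assume "GDERIV g v :> D'" and "GDERIV g v :> D"
  then have "(\<lambda>h. inner h D') = (\<lambda>h. inner h D)"
    unfolding gderiv_def by (rule has_derivative_unique)
  then have "inner (D' - D) D' = inner (D' - D) D" by metis
  then have "inner (D' - D) (D' - D) = 0" by (simp add: inner_diff_right)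
  then show "D' = D" by simp
qed

definition invertible_matrix_on :: "'i set \<Rightarrow> ('i \<Rightarrow> 'i \<Rightarrow> real) \<Rightarrow> bool" where
  "invertible_matrix_on A B \<longleftrightarrow> (\<exists>C. \<forall>a\<in>A. \<forall>b\<in>A.
     (\<Sum>c\<in>A. B a c * C c b) = (if a = b then 1 else 0) \<and>
     (\<Sum>c\<in>A. C a c * B c b) = (if a = b then 1 else 0))"

definition matrix_spectral_radius :: "real^'m^'m \<Rightarrow> real" where
  "matrix_spectral_radius A =
     Sup {cmod c | c. \<exists>v :: complex^'m. v \<noteq> 0 \<and> map_matrix complex_of_real A *v v = c *s v}"

text \<open>
  The variance with values in \<open>[0,\<infinity>]\<close>: for measurable \<open>Z\<close> it is the usual variance if \<open>Z\<close> is
  square-integrable, and \<open>\<infinity>\<close> otherwise.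
\<close>

definition ext_variance :: "'w measure \<Rightarrow> ('w \<Rightarrow> real) \<Rightarrow> ennreal" where
  "ext_variance M Z = (\<integral>\<^sup>+\<omega>. ennreal ((Z \<omega> - (\<integral>\<omega>'. Z \<omega>' \<partial>M))\<^sup>2) \<partial>M)"

lemma (in prob_space) ext_variance_eq_variance:
  fixes Z :: "'a \<Rightarrow> real"
  assumes [measurable]: "random_variable borel Z" and sq: "integrable M (\<lambda>\<omega>. (Z \<omega>)\<^sup>2)"
  shows "ext_variance M Z = ennreal (variance Z)"
proof -
  have "integrable M Z"
    using square_integrable_imp_integrable[OF assms] .
  then have "integrable M (\<lambda>\<omega>. (Z \<omega> - expectation Z)\<^sup>2)"
    using sq by (simp add: power2_diff)
  then show ?thesis
    unfolding ext_variance_def by (intro nn_integral_eq_integral) auto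
qed

lemma (in prob_space) ext_variance_eq_top:
  fixes Z :: "'a \<Rightarrow> real"
  assumes [measurable]: "random_variable borel Z" and sq: "\<not> integrable M (\<lambda>\<omega>. (Z \<omega>)\<^sup>2)"
  shows "ext_variance M Z = \<infinity>"
proof (rule ccontr)
  let ?c = "expectation Z"
  assume "ext_variance M Z \<noteq> \<infinity>"
  then have i: "integrable M (\<lambda>\<omega>. (Z \<omega> - ?c)\<^sup>2)"
    unfolding ext_variance_def by (intro integrableI_nonneg) (auto simp: less_top)
  moreover have "integrable M (\<lambda>\<omega>. Z \<omega> - ?c)"
    by (rule square_integrable_imp_integrable[OF _ i]) simp
  ultimately have "integrable M (\<lambda>\<omega>. (Z \<omega> - ?c)\<^sup>2 + 2 * ?c * (Z \<omega> - ?c) + ?c\<^sup>2)"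
    by simp
  moreover have "(\<lambda>\<omega>. (Z \<omega> - ?c)\<^sup>2 + 2 * ?c * (Z \<omega> - ?c) + ?c\<^sup>2) = (\<lambda>\<omega>. (Z \<omega>)\<^sup>2)"
    by (auto simp: power2_eq_square algebra_simps)
  ultimately show False using sq by simp
qed


section \<open>The statistical model and the regularity assumption\<close>

text \<open>
  A density \<open>p y x z\<close> stands for \<open>p\<^sub>y(z | x)\<close>. The parameter \<open>(y\<^sub>0, \<dots>, y\<^sub>n\<^sub>-\<^sub>1)\<close> is represented by a
  function on \<open>nat\<close> whose values at \<open>k \<ge> n\<close> are irrelevant; its differential calculus is expressed
  through the blocks \<open>y\<^sub>k\<close>, i.e. through the maps \<open>v \<mapsto> F (y(k := v))\<close> at \<open>v = y k\<close>. Since the density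
  is a product of factors each depending on one \<open>y\<^sub>k\<close> only, this amounts to its joint
  differentiability.
\<close>

definition path_density ::
    "('x \<Rightarrow> real) \<Rightarrow> ('y \<Rightarrow> 'x \<Rightarrow> 'x \<Rightarrow> real) \<Rightarrow> nat \<Rightarrow> (nat \<Rightarrow> 'y) \<Rightarrow> (nat \<Rightarrow> 'x) \<Rightarrow> real" where
  "path_density \<pi> p n y x = \<pi> (x 0) * (\<Prod>k=1..n. p (y (k - 1)) (x (k - 1)) (x k))"

definition path_model ::
    "'x measure \<Rightarrow> ('x \<Rightarrow> real) \<Rightarrow> ('y \<Rightarrow> 'x \<Rightarrow> 'x \<Rightarrow> real) \<Rightarrow> nat \<Rightarrow> (nat \<Rightarrow> 'y) \<Rightarrow> (nat \<Rightarrow> 'x) measure"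
where
  "path_model \<nu> \<pi> p n y =
     density (PiM {0..<Suc n} (\<lambda>_. \<nu>)) (\<lambda>x. ennreal (path_density \<pi> p n y x))"

definition path_score ::
    "('x \<Rightarrow> real) \<Rightarrow> ('y::real_inner \<Rightarrow> 'x \<Rightarrow> 'x \<Rightarrow> real) \<Rightarrow> nat \<Rightarrow> (nat \<Rightarrow> 'y) \<Rightarrow> nat \<Rightarrow> (nat \<Rightarrow> 'x) \<Rightarrow> 'y"
where
  "path_score \<pi> p n y k x = gradient (\<lambda>v. ln (path_density \<pi> p n (y(k := v)) x)) (y k)"

text \<open>
  Entries of the full Fisher information matrix, indexed by pairs \<open>(k, i)\<close> with \<open>k < n\<close> and \<open>i\<close> a
  coordinate of the block \<open>y\<^sub>k\<close>.
\<close>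

definition path_fisher ::
    "'x measure \<Rightarrow> ('x \<Rightarrow> real) \<Rightarrow> (real^'m \<Rightarrow> 'x \<Rightarrow> 'x \<Rightarrow> real) \<Rightarrow> nat \<Rightarrow> (nat \<Rightarrow> real^'m)
      \<Rightarrow> nat \<times> 'm \<Rightarrow> nat \<times> 'm \<Rightarrow> real" where
  "path_fisher \<nu> \<pi> p n y a b =
     (\<integral>x. path_score \<pi> p n y (fst a) x $ snd a * path_score \<pi> p n y (fst b) x $ snd b
       \<partial>path_model \<nu> \<pi> p n y)"

definition transition_score :: "('y::real_inner \<Rightarrow> 'x \<Rightarrow> 'x \<Rightarrow> real) \<Rightarrow> 'y \<Rightarrow> 'x \<Rightarrow> 'x \<Rightarrow> 'y" where
  "transition_score p y x z = gradient (\<lambda>v. ln (p v x z)) y"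

text \<open>
  \<open>\<nu>\<close> is \<open>\<sigma>\<close>-finite, as Radon-Nikodym densities and the powers \<open>\<nu>\<^sup>\<otimes>\<^sup>(\<^sup>n\<^sup>+\<^sup>1\<^sup>)\<close> require. The densities
  \<open>\<pi>\<close> and \<open>p\<close> are arbitrary nonnegative measurable versions of the Radon-Nikodym derivatives, since
  \<open>RN_deriv\<close> itself picks an unspecified version for each parameter value, for which
  differentiability would be meaningless. Measurability of the score makes
  \<open>\<partial>\<^sub>y log p\<^sub>y(X\<^sub>k\<^sub>+\<^sub>1 | X\<^sub>k)\<close> at \<open>y = Y\<^sub>k\<close> a random variable; it is automatic if \<open>v \<mapsto> p v x z\<close> is
  differentiable for all \<open>x\<close> and \<open>z\<close>.

  The interchange of differentiation with the integration of the density is required both for the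
  integral over all of \<open>(x\<^sub>0, \<dots>, x\<^sub>n)\<close> and for its innermost integral over \<open>x\<^sub>n\<close>, i.e. for the
  conditional densities \<open>p\<^sub>y(\<cdot> | x)\<close>. It is the latter that makes the scores of different transitions
  uncorrelated, so that the Fisher information matrix is block diagonal.
\<close>

locale cramer_rao_regular = sigma_finite_measure \<nu>
  for \<nu> :: "'x::polish_space measure" +
  fixes Q :: "real^'m \<Rightarrow> 'x \<Rightarrow> 'x measure"
    and \<mu>0 :: "'x measure"
    and \<pi> :: "'x \<Rightarrow> real"
    and p :: "real^'m \<Rightarrow> 'x \<Rightarrow> 'x \<Rightarrow> real"
    and \<Phi> :: "'x \<Rightarrow> real"
  assumes nu_borel: "sets \<nu> = sets borel"
    and Q_abs_cont: "\<And>y x. absolutely_continuous \<nu> (Q y x)"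
    and p_measurable: "\<And>y. (\<lambda>(x, z). p y x z) \<in> borel_measurable (borel \<Otimes>\<^sub>M borel)"
    and p_nonneg: "\<And>y x z. 0 \<le> p y x z"
    and p_density: "\<And>y x. AE z in \<nu>. ennreal (p y x z) = RN_deriv \<nu> (Q y x) z"
    and pi_measurable: "\<pi> \<in> borel_measurable borel"
    and pi_nonneg: "\<And>x. 0 \<le> \<pi> x"
    and pi_density: "AE x in \<nu>. ennreal (\<pi> x) = RN_deriv \<nu> \<mu>0 x"
    and score_measurable:
      "(\<lambda>(y, x, z). transition_score p y x z) \<in> borel_measurable (borel \<Otimes>\<^sub>M borel \<Otimes>\<^sub>M borel)"
    and density_differentiable:
      "\<And>n y k x. 1 \<le> n \<Longrightarrow> k < n \<Longrightarrow>
         (\<lambda>v. path_density \<pi> p n (y(k := v)) x) differentiable (at (y k))"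
    and fisher_finite:
      "\<And>n y a b. 1 \<le> n \<Longrightarrow> a \<in> {..<n} \<times> UNIV \<Longrightarrow> b \<in> {..<n} \<times> UNIV \<Longrightarrow>
         integrable (path_model \<nu> \<pi> p n y)
           (\<lambda>x. path_score \<pi> p n y (fst a) x $ snd a * path_score \<pi> p n y (fst b) x $ snd b)"
    and fisher_invertible:
      "\<And>n y. 1 \<le> n \<Longrightarrow> invertible_matrix_on ({..<n} \<times> UNIV) (path_fisher \<nu> \<pi> p n y)"
    and estimator_square_integrable:
      "\<And>n y l. 1 \<le> n \<Longrightarrow> l \<in> {1..n} \<Longrightarrow>
         integrable (path_model \<nu> \<pi> p n y) (\<lambda>x. (\<Phi> (x l))\<^sup>2)"
    and interchange_density:
      "\<And>n y k. 1 \<le> n \<Longrightarrow> k < n \<Longrightarrow>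
         GDERIV (\<lambda>v. \<integral>x. path_density \<pi> p n (y(k := v)) x \<partial>PiM {0..<Suc n} (\<lambda>_. \<nu>)) (y k)
           :> (\<integral>x. gradient (\<lambda>v. path_density \<pi> p n (y(k := v)) x) (y k) \<partial>PiM {0..<Suc n} (\<lambda>_. \<nu>))"
    and interchange_conditional_density:
      "\<And>n y k. 1 \<le> n \<Longrightarrow> k < n \<Longrightarrow> AE x in PiM {0..<n} (\<lambda>_. \<nu>).
         GDERIV (\<lambda>v. \<integral>z. path_density \<pi> p n (y(k := v)) (x(n := z)) \<partial>\<nu>) (y k)
           :> (\<integral>z. gradient (\<lambda>v. path_density \<pi> p n (y(k := v)) (x(n := z))) (y k) \<partial>\<nu>)"
    and interchange_estimator:
      "\<And>n y k l. 1 \<le> n \<Longrightarrow> k < n \<Longrightarrow> l \<in> {1..n} \<Longrightarrow>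
         GDERIV (\<lambda>v. \<integral>x. \<Phi> (x l) * path_density \<pi> p n (y(k := v)) x \<partial>PiM {0..<Suc n} (\<lambda>_. \<nu>)) (y k)
           :> (\<integral>x. \<Phi> (x l) *\<^sub>R gradient (\<lambda>v. path_density \<pi> p n (y(k := v)) x) (y k)
                 \<partial>PiM {0..<Suc n} (\<lambda>_. \<nu>))"


section \<open>The conditional Fisher information matrices\<close>

definition environment_algebra ::
    "'w measure \<Rightarrow> (nat \<Rightarrow> 'w \<Rightarrow> 'y::topological_space) \<Rightarrow> nat \<Rightarrow> 'w measure" where
  "environment_algebra M Y n =
     vimage_algebra (space M) (\<lambda>\<omega>. \<lambda>i\<in>{..<n}. Y i \<omega>) (PiM {..<n} (\<lambda>_. borel))"

text \<open>
  \<open>real_cond_exp\<close> treats positive and negative parts separately, so it is the conditional expectation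
  also where the conditional moments are finite but the unconditional ones are not.
\<close>

definition cond_fisher ::
    "'w measure \<Rightarrow> (nat \<Rightarrow> 'w \<Rightarrow> real^'m) \<Rightarrow> (nat \<Rightarrow> 'w \<Rightarrow> 'x) \<Rightarrow> (real^'m \<Rightarrow> 'x \<Rightarrow> 'x \<Rightarrow> real)
      \<Rightarrow> nat \<Rightarrow> nat \<Rightarrow> 'w \<Rightarrow> real^'m^'m" where
  "cond_fisher M Y X p n k \<omega> =
     (\<chi> i j. real_cond_exp M (environment_algebra M Y n)
        (\<lambda>\<omega>'. transition_score p (Y k \<omega>') (X k \<omega>') (X (Suc k) \<omega>') $ i *
              transition_score p (Y k \<omega>') (X k \<omega>') (X (Suc k) \<omega>') $ j) \<omega>)"

end

theory Submission
  imports Defs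
begin

text \<open>
  For a frozen environment \<open>y\<close> the scores \<open>s\<^sub>k\<close> of the transitions are centred, mutually uncorrelated
  (they are martingale differences), and satisfy \<open>E\<^sub>y[S\<^sub>n s\<^sub>k] = b\<^sub>k\<close>, the gradient of \<open>E\<^sub>y[S\<^sub>n]\<close> in \<open>y\<^sub>k\<close>.
  With \<open>Z = (\<Sum>k. (b\<^sub>k / r\<^sub>k) \<bullet> s\<^sub>k)\<close>, where \<open>r\<^sub>k\<close> is the spectral radius of the Fisher information \<open>I\<^sub>k\<close>, and
  \<open>T = (\<Sum>k. \<parallel>b\<^sub>k\<parallel>\<^sup>2 / r\<^sub>k)\<close>, we have \<open>E\<^sub>y[(S\<^sub>n - c) Z] = T\<close> and \<open>E\<^sub>y[Z\<^sup>2] \<le> T\<close>, so that expanding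
  \<open>E\<^sub>y[(S\<^sub>n - c - Z)\<^sup>2] \<ge> 0\<close> gives \<open>E\<^sub>y[(S\<^sub>n - c)\<^sup>2] \<ge> T\<close> for every constant \<open>c\<close>. Taking \<open>c = E[S\<^sub>n]\<close> and
  integrating over the law of the environment yields the theorem.
\<close>

section \<open>Lower integrals and spectral radii\<close>

text \<open>Two notions of conditioning have to be matched: the gradient belongs to a function of
  deterministic environments, while \<open>cond_fisher\<close> is a version of a conditional
  expectation and so fixed only almost everywhere. The link is that \<open>X 0\<close>, the
  environment and the noise have a product joint law and that the path is an explicit measurable
  function of them, so that freezing the environment amounts to conditioning on it. Origin of the
  coefficients: a test variable with coefficient a for transition k contributes 2 (a \<bullet> b) -
  a \<bullet> (I a), which is at least 2 (a \<bullet> b) - r |a|^2; this is largest at a = b / r,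
  with value |b|^2 / r. One constant c serves all environments, although the conditional mean of the
  sum varies with them, because centred scores are uncorrelated with constants. The sum may have
  infinite variance under \<open>M\<close> even though every frozen law gives it finite variance, so
  the integration over environments uses nonnegative integrals only. Measurability of the gradients
  and spectral radii in the environment is not established; this is why lower integrals
  appear.\<close>

text \<open>Measurability is not assumed: \<open>nn_integral\<close> is a lower integral, hence superadditive.\<close>

lemma nn_integral_superadditive:
  "(\<integral>\<^sup>+x. f x \<partial>M) + (\<integral>\<^sup>+x. g x \<partial>M) \<le> (\<integral>\<^sup>+x. f x + g x \<partial>M)"
proof -
  let ?S = "\<lambda>h. {s. simple_function M s \<and> s \<le> h}"
  have ne: "?S f \<noteq> {}" "?S g \<noteq> {}"
    by (auto intro!: exI[of _ "\<lambda>_. 0"] simp: le_fun_def)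
  have "integral\<^sup>S M s + integral\<^sup>S M t \<le> (\<integral>\<^sup>+x. f x + g x \<partial>M)"
    if "s \<in> ?S f" "t \<in> ?S g" for s t
  proof -
    have "integral\<^sup>S M s + integral\<^sup>S M t = (\<integral>\<^sup>+x. s x \<partial>M) + (\<integral>\<^sup>+x. t x \<partial>M)"
      using that by (simp add: nn_integral_eq_simple_integral)
    also have "\<dots> = (\<integral>\<^sup>+x. s x + t x \<partial>M)"
      using that by (intro nn_integral_add[symmetric]) (auto intro: borel_measurable_simple_function)
    also have "\<dots> \<le> (\<integral>\<^sup>+x. f x + g x \<partial>M)"
      using that by (intro nn_integral_mono add_mono) (auto simp: le_fun_def)
    finally show ?thesis .
  qed
  \<comment> \<open>Both suprema are moved outside the sum; \<open>ne\<close> is needed because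
    adding a constant commutes with a supremum in \<open>ennreal\<close> only over a nonempty index
    set.\<close>
  then show ?thesis
    unfolding nn_integral_def[of M f] nn_integral_def[of M g]
    by (simp only: ennreal_SUP_add_left[OF ne(1), symmetric] ennreal_SUP_add_right[OF ne(2)])
      (intro SUP_least)
qed

lemma sum_nn_integral_le:
  "(\<Sum>k\<in>A. \<integral>\<^sup>+x. f k x \<partial>M) \<le> (\<integral>\<^sup>+x. (\<Sum>k\<in>A. f k x) \<partial>M)"
proof (induction A rule: infinite_finite_induct)
  case (insert a A)
  then show ?case
    using nn_integral_superadditive[where f="f a" and g="\<lambda>x. \<Sum>k\<in>A. f k x" and M=M]
    by (auto intro: order_trans add_left_mono)
qed auto

section \<open>The spectral radius of a symmetric matrix bounds its quadratic form\<close>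

lemma nonneg_form_eq_0_imp_kernel:
  fixes B :: "real^'m^'m"
  assumes sym: "transpose B = B" and nonneg: "\<And>x. 0 \<le> x \<bullet> (B *v x)" and v: "v \<bullet> (B *v v) = 0"
  shows "B *v v = 0"
proof (rule ccontr)
  assume ne: "B *v v \<noteq> 0"
  \<comment> \<open>The form is minimal at \<open>v\<close>, so its linear term must vanish in every
    direction; the direction \<open>B *v v\<close> makes that term a multiple of
    \<open>w \<bullet> w\<close>.\<close>
  define w where "w = B *v v"
  have "v \<bullet> (B *v w) = w \<bullet> w"
    by (metis dot_lmul_matrix sym vector_transpose_matrix w_def)
  then have expand: "(v + t *\<^sub>R w) \<bullet> (B *v (v + t *\<^sub>R w)) = 2 * t * (w \<bullet> w) + t\<^sup>2 * (w \<bullet> (B *v w))" for t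
    using v by (simp add: matrix_vector_right_distrib matrix_vector_mult_scaleR inner_simps
        power2_eq_square w_def[symmetric] algebra_simps inner_commute)
  define q where "q = w \<bullet> (B *v w)"
  have "0 \<le> q" "0 < w \<bullet> w" using nonneg ne by (auto simp: q_def w_def)
  \<comment> \<open>The exact minimiser would be \<open>- (w \<bullet> w) / q\<close>; the
    denominator \<open>q + 1\<close> also covers \<open>q = 0\<close> and still gives a negative
    value.\<close>
  define t where "t = - (w \<bullet> w) / (q + 1)"
  have "0 \<le> 2 * t * (w \<bullet> w) + t\<^sup>2 * q"
    using nonneg[of "v + t *\<^sub>R w"] expand[of t] by (simp add: q_def)
  also have "\<dots> = (w \<bullet> w)\<^sup>2 / (q + 1) * (q / (q + 1) - 2)"
    using \<open>0 \<le> q\<close> by (simp add: t_def power2_eq_square divide_simps) (simp add: algebra_simps)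
  also have "\<dots> < 0"
    using \<open>0 \<le> q\<close> \<open>0 < w \<bullet> w\<close> by (intro mult_pos_neg) (auto simp: field_simps)
  finally show False by simp
qed

text \<open>A maximiser of the form on the compact unit sphere is an eigenvector: with
  \<open>l\<close> the maximum, \<open>mat l - A\<close> is a nonnegative form that vanishes there,
  so the maximiser lies in its kernel.\<close>

lemma symmetric_matrix_maximal_eigenvalue:
  fixes A :: "real^'m^'m"
  assumes sym: "transpose A = A"
  obtains l v where "v \<noteq> 0" "A *v v = l *\<^sub>R v" "\<And>x. x \<bullet> (A *v x) \<le> l * (norm x)\<^sup>2"
proof -
  have "compact (sphere (0::real^'m) 1)" "sphere (0::real^'m) 1 \<noteq> {}"
    by (auto intro!: exI[of _ "axis undefined 1"])
  moreover have "continuous_on (sphere 0 1) (\<lambda>x. x \<bullet> (A *v x))"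
    by (intro continuous_intros linear_continuous_on matrix_vector_mul_bounded_linear)
  ultimately obtain v where v: "v \<in> sphere 0 1"
    and max: "\<And>x. x \<in> sphere 0 1 \<Longrightarrow> x \<bullet> (A *v x) \<le> v \<bullet> (A *v v)"
    using continuous_attains_sup[of "sphere 0 1" "\<lambda>x. x \<bullet> (A *v x)"] by metis
  define l where "l = v \<bullet> (A *v v)"
  have le: "x \<bullet> (A *v x) \<le> l * (norm x)\<^sup>2" for x
  proof (cases "x = 0")
    case False
    define u where "u = x /\<^sub>R norm x"
    have x: "x = norm x *\<^sub>R u" using False by (simp add: u_def)
    have "u \<in> sphere 0 1" using False by (simp add: u_def)
    from max[OF this] have "u \<bullet> (A *v u) \<le> l" by (simp add: l_def)
    moreover have "x \<bullet> (A *v x) = (norm x)\<^sup>2 * (u \<bullet> (A *v u))"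
      by (subst (1 2) x) (simp only: matrix_vector_mult_scaleR inner_scaleR_left inner_scaleR_right power2_eq_square mult.assoc)
    ultimately show ?thesis by (metis mult.commute mult_left_mono zero_le_power2)
  qed simp
  define B where "B = mat l - A"
  have B: "B *v x = l *\<^sub>R x - A *v x" for x
    unfolding B_def by (simp add: matrix_vector_mult_diff_rdistrib)
      (simp add: vec_eq_iff matrix_vector_mult_def mat_def if_distrib if_distribR cong: if_cong)
  have "transpose B = B"
    using sym unfolding B_def by (simp add: vec_eq_iff transpose_def mat_def)
  moreover have "0 \<le> x \<bullet> (B *v x)" for x
    using le[of x] by (simp add: B inner_diff_right power2_norm_eq_inner)
  moreover have "v \<bullet> (B *v v) = 0"
    using v by (simp add: B inner_diff_right l_def norm_eq_1)
  ultimately have "B *v v = 0" by (rule nonneg_form_eq_0_imp_kernel)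
  then have "A *v v = l *\<^sub>R v" by (simp add: B)
  moreover have "v \<noteq> 0" using v by auto
  ultimately show thesis using that le by blast
qed

text \<open>A real \<open>Sup\<close> bounds the members of a set only if the set is bounded above;
  the operator norm provides the bound.\<close>

lemma bdd_above_eigenvalues:
  fixes B :: "complex^'m^'m"
  shows "bdd_above {cmod c | c. \<exists>v. v \<noteq> 0 \<and> B *v v = c *s v}"
proof (rule bdd_aboveI[of _ "onorm ((*v) B)"], safe)
  fix c and v :: "complex^'m" assume "v \<noteq> 0" and e: "B *v v = c *s v"
  have "cmod c * norm v = norm (c *s v)"
    by (simp add: norm_vec_def L2_set_def norm_mult power_mult_distrib sum_distrib_left[symmetric] real_sqrt_mult)
  also have "\<dots> \<le> onorm ((*v) B) * norm v"
    using onorm[OF matrix_vector_mul_bounded_linear, of B v] by (simp add: e)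
  finally show "cmod c \<le> onorm ((*v) B)" using \<open>v \<noteq> 0\<close> by simp
qed

text \<open>The largest real eigenvalue, with its eigenvector regarded as a complex one, belongs to
  the set whose supremum is the spectral radius, and it already dominates the form.\<close>

lemma matrix_spectral_radius_symmetric:
  fixes A :: "real^'m^'m"
  assumes sym: "transpose A = A"
  shows "x \<bullet> (A *v x) \<le> matrix_spectral_radius A * (norm x)\<^sup>2" "0 \<le> matrix_spectral_radius A"
proof -
  obtain l v where v: "v \<noteq> 0" "A *v v = l *\<^sub>R v" and le: "\<And>x. x \<bullet> (A *v x) \<le> l * (norm x)\<^sup>2"
    using symmetric_matrix_maximal_eigenvalue[OF sym] by metis
  define w :: "complex^'m" where "w = (\<chi> i. of_real (v $ i))"
  have "w \<noteq> 0" using v(1) by (auto simp: w_def vec_eq_iff)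
  moreover have "map_matrix complex_of_real A *v w = complex_of_real l *s w"
    using v(2) by (simp add: w_def vec_eq_iff matrix_vector_mult_def map_matrix_def of_real_mult[symmetric]
        of_real_sum[symmetric] del: of_real_mult of_real_sum)
  ultimately have "cmod (complex_of_real l) \<le> matrix_spectral_radius A"
    unfolding matrix_spectral_radius_def by (intro cSup_upper bdd_above_eigenvalues) blast
  then have l: "\<bar>l\<bar> \<le> matrix_spectral_radius A" by simp
  then show "0 \<le> matrix_spectral_radius A" by simp
  show "x \<bullet> (A *v x) \<le> matrix_spectral_radius A * (norm x)\<^sup>2"
    using le[of x] l by (smt (verit) mult_right_mono zero_le_power2)
qed

section \<open>The chain in a frozen environment\<close>

abbreviation paths :: "nat \<Rightarrow> (nat \<Rightarrow> 'x::topological_space) measure" where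
  "paths n \<equiv> PiM {0..<n} (\<lambda>_. borel)"

text \<open>Measurability of the kernel is required in the state only, since the environment is a
  fixed parameter here. Dependence on the environment is controlled later, through a representation
  by independent uniform variables.\<close>

locale frozen_chain =
  fixes Q :: "'y \<Rightarrow> 'x::polish_space \<Rightarrow> 'x measure" and \<mu>0 :: "'x measure"
  assumes kernel_measurable: "\<And>y. Q y \<in> borel \<rightarrow>\<^sub>M prob_algebra borel"
    and initial_law: "\<mu>0 \<in> space (prob_algebra borel)"
begin

lemma prob_space_kernel: "prob_space (Q y x)"
  and sets_kernel [measurable_cong]: "sets (Q y x) = sets borel"
  using measurable_space[OF kernel_measurable, of x y] by (auto simp: space_prob_algebra)

lemma prob_space_initial: "prob_space \<mu>0"
  and sets_initial [measurable_cong]: "sets \<mu>0 = sets borel"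
  using initial_law by (auto simp: space_prob_algebra)

lemma kernel_subprob: "Q y \<in> borel \<rightarrow>\<^sub>M subprob_algebra borel"
  using kernel_measurable by (rule measurable_prob_algebraD)

lemma Ionescu_Tulcea_kernel:
  "Ionescu_Tulcea (\<lambda>i x. case i of 0 \<Rightarrow> \<mu>0 | Suc k \<Rightarrow> Q (y k) (x k)) (\<lambda>_. borel)"
proof (rule Ionescu_Tulcea.intro, goal_cases)
  case (1 i)
  have "\<mu>0 \<in> space (subprob_algebra borel)"
    using prob_space_initial by (simp add: space_subprob_algebra sets_initial prob_space_imp_subprob_space)
  moreover have "(\<lambda>x. Q (y k) (x k)) \<in> PiM {0..<Suc k} (\<lambda>_. borel) \<rightarrow>\<^sub>M subprob_algebra borel" for k
    using measurable_compose[OF measurable_component_singleton[of k "{0..<Suc k}" "\<lambda>_. borel"]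
        kernel_subprob[of "y k"]] by simp
  ultimately show ?case
    by (cases i) (simp_all only: nat.case measurable_const)
next
  case (2 i x)
  show ?case
    using prob_space_initial prob_space_kernel by (cases i) (simp_all only: nat.case)
qed

context
  fixes y :: "nat \<Rightarrow> 'y"
begin

interpretation IT: Ionescu_Tulcea "\<lambda>i x. case i of 0 \<Rightarrow> \<mu>0 | Suc k \<Rightarrow> Q (y k) (x k)" "\<lambda>_. borel"
  by (rule Ionescu_Tulcea_kernel)

lemma sets_frozen_law [measurable_cong]: "sets (frozen_law Q \<mu>0 n y) = sets (paths (Suc n))"
  using IT.sets_C[of "\<lambda>_. undefined" 0 "Suc n"] by (simp add: frozen_law_def del: IT.C.simps)

lemma space_frozen_law: "space (frozen_law Q \<mu>0 n y) = space (paths (Suc n))"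
  using sets_frozen_law by (rule sets_eq_imp_space_eq)

lemma prob_space_frozen_law: "prob_space (frozen_law Q \<mu>0 n y)"
  using IT.prob_space_C[of "\<lambda>_. undefined" 0 "Suc n"] by (simp add: frozen_law_def del: IT.C.simps)

text \<open>Truncation lets a claim about transition k be proved at horizon k + 1, where its
  endpoint is the last coordinate.\<close>

lemma frozen_law_marginal:
  "m \<le> n \<Longrightarrow> frozen_law Q \<mu>0 m y =
     distr (frozen_law Q \<mu>0 n y) (paths (Suc m)) (\<lambda>x. restrict x {0..<Suc m})"
  using IT.distr_C[of "Suc m" "Suc n" "\<lambda>_. undefined" 0] by (simp add: frozen_law_def del: IT.C.simps)

lemma nn_integral_frozen_law_0:
  assumes [measurable]: "h \<in> borel_measurable (paths (Suc 0))"
  shows "(\<integral>\<^sup>+x. h x \<partial>frozen_law Q \<mu>0 0 y) = (\<integral>\<^sup>+z. h ((\<lambda>_. undefined)(0 := z)) \<partial>\<mu>0)"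
proof -
  have s: "(\<lambda>_. undefined) \<in> space (Pi\<^sub>M {0..<0::nat} (\<lambda>_. borel :: 'x measure))"
    by (simp add: space_PiM)
  have "frozen_law Q \<mu>0 0 y = IT.eP 0 (\<lambda>_. undefined)"
    unfolding frozen_law_def IT.C.simps add_0_left by (rule bind_return[OF IT.measurable_eP s])
  then show ?thesis
    using IT.nn_integral_eP[OF s assms] by simp
qed

text \<open>The tower property, last coordinate innermost. It drives both inductions on the horizon:
  the representation by uniform variables and the one by densities.\<close>

lemma nn_integral_frozen_law_Suc:
  assumes [measurable]: "h \<in> borel_measurable (paths (Suc (Suc n)))"
  shows "(\<integral>\<^sup>+x. h x \<partial>frozen_law Q \<mu>0 (Suc n) y) =
    (\<integral>\<^sup>+x. \<integral>\<^sup>+z. h (x(Suc n := z)) \<partial>Q (y n) (x n) \<partial>frozen_law Q \<mu>0 n y)"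
proof -
  have bind: "frozen_law Q \<mu>0 (Suc n) y = frozen_law Q \<mu>0 n y \<bind> IT.eP (Suc n)"
    unfolding frozen_law_def by (subst IT.C.simps(2)) (simp only: add_0_left)
  have eP: "IT.eP (Suc n) \<in> frozen_law Q \<mu>0 n y \<rightarrow>\<^sub>M subprob_algebra (paths (Suc (Suc n)))"
    unfolding measurable_cong_sets[OF sets_frozen_law refl] by (rule IT.measurable_eP)
  have int_eP: "(\<integral>\<^sup>+z. h z \<partial>IT.eP (Suc n) x) = (\<integral>\<^sup>+z. h (x(Suc n := z)) \<partial>Q (y n) (x n))"
    if "x \<in> space (frozen_law Q \<mu>0 n y)" for x
    using IT.nn_integral_eP[OF that[unfolded space_frozen_law] assms] by (simp only: nat.case)
  show ?thesis
    unfolding bind nn_integral_bind[OF assms eP] by (rule nn_integral_cong) (rule int_eP)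
qed

end

end

lemma measurable_path_update:
  assumes "g \<in> N \<rightarrow>\<^sub>M PiM {0..<Suc n} (\<lambda>_. L)" "h \<in> N \<rightarrow>\<^sub>M L"
  shows "(\<lambda>w. (g w)(Suc n := h w)) \<in> N \<rightarrow>\<^sub>M PiM {0..<Suc (Suc n)} (\<lambda>_. L)"
  using assms by (intro measurable_fun_upd[where J="{0..<Suc n}"]) auto

text \<open>The path as an explicit function of start, environment and noise. Noise is indexed from
  0: \<open>u k\<close> drives the step from k to k + 1 and stands for
  \<open>eps (Suc k)\<close>.\<close>

primrec env_path :: "('x \<Rightarrow> 'y \<Rightarrow> 'u \<Rightarrow> 'x) \<Rightarrow> (nat \<Rightarrow> 'y) \<Rightarrow> 'x \<Rightarrow> (nat \<Rightarrow> 'u) \<Rightarrow> nat \<Rightarrow> 'x" where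
  "env_path f y x u 0 = x"
| "env_path f y x u (Suc k) = f (env_path f y x u k) (y k) (u k)"

lemma env_path_cong:
  assumes "\<And>i. i < k \<Longrightarrow> y i = y' i" "\<And>i. i < k \<Longrightarrow> u i = u' i"
  shows "env_path f y x u k = env_path f y' x u' k"
  using assms by (induction k) auto

lemma prob_space_unit_uniform: "prob_space unit_uniform"
  by (intro prob_spaceI) (simp add: emeasure_restrict_space space_restrict_space)

interpretation unit_uniform: prob_space unit_uniform
  by (rule prob_space_unit_uniform)

interpretation unit_uniforms: product_sigma_finite "\<lambda>_. unit_uniform"
  by unfold_locales

locale random_map =
  fixes f :: "'x::polish_space \<Rightarrow> 'y::topological_space \<Rightarrow> real \<Rightarrow> 'x"
  assumes random_map_measurable:
    "(\<lambda>(x, y, u). f x y u) \<in> borel \<Otimes>\<^sub>M borel \<Otimes>\<^sub>M unit_uniform \<rightarrow>\<^sub>M borel"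
begin

lemma measurable_random_map [measurable (raw)]:
  assumes "g \<in> N \<rightarrow>\<^sub>M borel" "h \<in> N \<rightarrow>\<^sub>M borel" "k \<in> N \<rightarrow>\<^sub>M unit_uniform"
  shows "(\<lambda>w. f (g w) (h w) (k w)) \<in> N \<rightarrow>\<^sub>M borel"
  using measurable_compose[OF measurable_Pair[OF assms(1) measurable_Pair[OF assms(2,3)]] random_map_measurable]
  by (simp only: prod.case)

lemma measurable_env_path [measurable (raw)]:
  assumes "x \<in> N \<rightarrow>\<^sub>M borel" "\<And>i. i < k \<Longrightarrow> (\<lambda>w. y w i) \<in> N \<rightarrow>\<^sub>M borel"
    "\<And>i. i < k \<Longrightarrow> (\<lambda>w. u w i) \<in> N \<rightarrow>\<^sub>M unit_uniform"
  shows "(\<lambda>w. env_path f (y w) (x w) (u w) k) \<in> N \<rightarrow>\<^sub>M borel"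
  using assms(2,3)
proof (induction k)
  case 0
  then show ?case using assms(1) by simp
next
  case (Suc k)
  have "(\<lambda>w. env_path f (y w) (x w) (u w) k) \<in> N \<rightarrow>\<^sub>M borel"
    by (rule Suc.IH) (use Suc.prems in auto)
  then show ?case
    unfolding env_path.simps using Suc.prems[of k] by (intro measurable_random_map) simp_all
qed

lemma param_kernel_measurable: "param_kernel f y \<in> borel \<rightarrow>\<^sub>M prob_algebra borel"
proof (rule measurable_prob_algebraI)
  show "prob_space (param_kernel f y x)" for x
    unfolding param_kernel_def by (intro unit_uniform.prob_space_distr) measurable
  have "(\<lambda>x. distr unit_uniform borel (f x y)) \<in> borel \<rightarrow>\<^sub>M subprob_algebra borel"
    by (rule measurable_distr2[where M=unit_uniform])
      (auto intro!: measurable_const simp: space_subprob_algebra unit_uniform.subprob_space_axioms)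
  then show "param_kernel f y \<in> borel \<rightarrow>\<^sub>M subprob_algebra borel"
    by (simp add: param_kernel_def[abs_def])
qed

lemma frozen_law_param_kernel:
  assumes "\<mu>0 \<in> space (prob_algebra borel)"
    and h: "h \<in> borel_measurable (PiM {0..<Suc n} (\<lambda>_. borel))"
  shows "(\<integral>\<^sup>+x. h x \<partial>frozen_law (param_kernel f) \<mu>0 n y) =
    (\<integral>\<^sup>+x. \<integral>\<^sup>+u. h (\<lambda>i\<in>{0..<Suc n}. env_path f y x u i) \<partial>PiM {..<n} (\<lambda>_. unit_uniform) \<partial>\<mu>0)"
proof -
  interpret frozen_chain "param_kernel f" \<mu>0
    using param_kernel_measurable assms(1) by unfold_locales
  show ?thesis using h
  proof (induction n arbitrary: h)
    case 0
    \<comment> \<open>With the single index 0 the restricted path is \<open>undefined\<close>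
      elsewhere, exactly as in the base case of the Ionescu-Tulcea construction.\<close>
    have eq: "(\<lambda>i\<in>{0..<Suc 0}. env_path f y x u i) = (\<lambda>_. undefined)(0 := x)" for x u
      by (auto simp: fun_eq_iff)
    show ?case
      unfolding nn_integral_frozen_law_0[OF 0] eq
      by (simp add: PiM_empty nn_integral_count_space_finite del: fun_upd_apply)
  next
    case (Suc n)
    note [measurable] = Suc.prems
    let ?H = "\<lambda>x. \<integral>\<^sup>+v. h (x(Suc n := f (x n) (y n) v)) \<partial>unit_uniform"
    have upd: "(\<lambda>w. h ((g w)(Suc n := k w))) \<in> borel_measurable N"
      if "g \<in> N \<rightarrow>\<^sub>M paths (Suc n)" "k \<in> N \<rightarrow>\<^sub>M borel" for g k and N :: "'z measure"
      using measurable_compose[OF measurable_path_update[OF that] Suc.prems] .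
    have [measurable]: "?H \<in> borel_measurable (paths (Suc n))"
      by (intro unit_uniform.borel_measurable_nn_integral) (unfold split_beta', intro upd, measurable)
    have "(\<integral>\<^sup>+x. h x \<partial>frozen_law (param_kernel f) \<mu>0 (Suc n) y) =
      (\<integral>\<^sup>+x. ?H x \<partial>frozen_law (param_kernel f) \<mu>0 n y)"
      unfolding nn_integral_frozen_law_Suc[OF Suc.prems]
      by (intro nn_integral_cong, subst param_kernel_def, intro nn_integral_distr upd measurable_const)
        (auto simp: space_frozen_law)
    also have "\<dots> = (\<integral>\<^sup>+x. \<integral>\<^sup>+u. ?H (\<lambda>i\<in>{0..<Suc n}. env_path f y x u i)
        \<partial>PiM {..<n} (\<lambda>_. unit_uniform) \<partial>\<mu>0)"
      by (rule Suc.IH) measurable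
    also have "\<dots> = (\<integral>\<^sup>+x. \<integral>\<^sup>+u. h (\<lambda>i\<in>{0..<Suc (Suc n)}. env_path f y x u i)
        \<partial>PiM {..<Suc n} (\<lambda>_. unit_uniform) \<partial>\<mu>0)"
    proof (rule nn_integral_cong)
      fix x
      \<comment> \<open>The path up to time n reads only the noise before n, so replacing
        \<open>u n\<close> by \<open>v\<close> leaves it alone and changes just the new last
        point.\<close>
      have eq: "(\<lambda>i\<in>{0..<Suc n}. env_path f y x u i)
            (Suc n := f ((\<lambda>i\<in>{0..<Suc n}. env_path f y x u i) n) (y n) v) =
          (\<lambda>i\<in>{0..<Suc (Suc n)}. env_path f y x (u(n := v)) i)" for u v
        by (auto simp: fun_eq_iff less_Suc_eq intro!: env_path_cong arg_cong2[where f="\<lambda>a b. f a b v"])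
      have path_measurable: "(\<lambda>u. \<lambda>i\<in>{0..<Suc (Suc n)}. env_path f y x u i)
          \<in> PiM (insert n {..<n}) (\<lambda>_. unit_uniform) \<rightarrow>\<^sub>M paths (Suc (Suc n))"
        by (intro measurable_restrict measurable_env_path measurable_const measurable_component_singleton) auto
      show "(\<integral>\<^sup>+u. ?H (\<lambda>i\<in>{0..<Suc n}. env_path f y x u i) \<partial>PiM {..<n} (\<lambda>_. unit_uniform)) =
        (\<integral>\<^sup>+u. h (\<lambda>i\<in>{0..<Suc (Suc n)}. env_path f y x u i) \<partial>PiM {..<Suc n} (\<lambda>_. unit_uniform))"
        unfolding lessThan_Suc eq
        by (rule unit_uniforms.product_nn_integral_insert[symmetric, OF _ _ measurable_compose[OF path_measurable Suc.prems]])
          simp_all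
    qed
    finally show ?case .
  qed
qed

end

locale regular_chain = cramer_rao_regular \<nu> Q \<mu>0 \<pi> p \<Phi> + frozen_chain Q \<mu>0
  for \<nu> :: "'x::polish_space measure"
    and Q :: "real^'m \<Rightarrow> 'x \<Rightarrow> 'x measure"
    and \<mu>0 \<pi> p \<Phi> +
  assumes initial_abs_cont: "absolutely_continuous \<nu> \<mu>0"
    and Phi_measurable [measurable]: "\<Phi> \<in> borel_measurable borel"
begin

sublocale product_sigma_finite "\<lambda>_::nat. \<nu>"
  by unfold_locales

declare nu_borel [measurable_cong]

abbreviation reference :: "nat \<Rightarrow> (nat \<Rightarrow> 'x) measure" where
  "reference n \<equiv> PiM {0..<n} (\<lambda>_. \<nu>)"

lemma sets_reference [measurable_cong]: "sets (reference n) = sets (paths n)"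
  by (intro sets_PiM_cong) (auto simp: nu_borel)

lemma measurable_p [measurable (raw)]:
  assumes "g \<in> N \<rightarrow>\<^sub>M borel" "h \<in> N \<rightarrow>\<^sub>M borel"
  shows "(\<lambda>w. p v (g w) (h w)) \<in> borel_measurable N"
  using measurable_compose[OF measurable_Pair[OF assms] p_measurable[of v]] by (simp only: prod.case)

lemma measurable_pi [measurable]: "\<pi> \<in> borel_measurable borel"
  by (rule pi_measurable)

lemma density_kernel: "density \<nu> (\<lambda>z. ennreal (p v x z)) = Q v x"
proof -
  have "density \<nu> (\<lambda>z. ennreal (p v x z)) = density \<nu> (RN_deriv \<nu> (Q v x))"
    by (intro density_cong p_density) measurable
  also have "\<dots> = Q v x"
    by (intro density_RN_deriv Q_abs_cont) (simp add: sets_kernel nu_borel)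
  finally show ?thesis .
qed

text \<open>Absolute continuity of the initial law enters here: it makes \<open>\<pi>\<close>, a
  version of the Radon-Nikodym derivative, an actual density of \<open>\<mu>0\<close>.\<close>

lemma density_initial: "density \<nu> (\<lambda>z. ennreal (\<pi> z)) = \<mu>0"
proof -
  have "density \<nu> (\<lambda>z. ennreal (\<pi> z)) = density \<nu> (RN_deriv \<nu> \<mu>0)"
    by (intro density_cong pi_density) measurable
  also have "\<dots> = \<mu>0"
    by (intro density_RN_deriv initial_abs_cont) (simp add: sets_initial nu_borel)
  finally show ?thesis .
qed

lemma nn_integral_kernel:
  assumes "h \<in> borel_measurable borel"
  shows "(\<integral>\<^sup>+z. h z \<partial>Q v x) = (\<integral>\<^sup>+z. ennreal (p v x z) * h z \<partial>\<nu>)"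
  unfolding density_kernel[symmetric] using assms by (intro nn_integral_density) measurable

text \<open>Normalisation at every parameter value; the vanishing derivative of this constant in
  \<open>v\<close> is what centres the scores.\<close>

lemma integral_p: "(\<integral>z. p v x z \<partial>\<nu>) = 1"
proof -
  have "(\<integral>\<^sup>+z. ennreal (p v x z) \<partial>\<nu>) = 1"
    using nn_integral_kernel[of "\<lambda>_. 1" v x] prob_space.emeasure_space_1[OF prob_space_kernel[of v x]] by simp
  then show ?thesis
    by (subst integral_eq_nn_integral) (auto simp: p_nonneg)
qed

lemma path_density_nonneg: "0 \<le> path_density \<pi> p n y x"
  unfolding path_density_def by (intro mult_nonneg_nonneg prod_nonneg) (auto simp: pi_nonneg p_nonneg)

lemma path_density_measurable [measurable]:
  "path_density \<pi> p n y \<in> borel_measurable (paths (Suc n))"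
  unfolding path_density_def[abs_def]
  by (intro borel_measurable_times borel_measurable_prod measurable_p
      measurable_compose[OF _ pi_measurable] measurable_component_singleton) auto

lemma path_density_Suc:
  "path_density \<pi> p (Suc n) y x = path_density \<pi> p n y x * p (y n) (x n) (x (Suc n))"
  by (simp add: path_density_def)

lemma path_density_cong:
  assumes "\<And>i. i < n \<Longrightarrow> y i = y' i" "\<And>i. i \<le> n \<Longrightarrow> x i = x' i"
  shows "path_density \<pi> p n y x = path_density \<pi> p n y' x'"
proof -
  have "p (y (k - 1)) (x (k - 1)) (x k) = p (y' (k - 1)) (x' (k - 1)) (x' k)" if "k \<in> {1..n}" for k
    using assms(1)[of "k - 1"] assms(2)[of "k - 1"] assms(2)[of k] that by auto
  then show ?thesis
    unfolding path_density_def using assms(2)[of 0] by (auto intro!: arg_cong2[where f="(*)"] prod.cong)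
qed

text \<open>The last kernel contributes the last factor of the path density, and the product measure
  is split at the last coordinate by Tonelli's theorem.\<close>

lemma nn_integral_frozen_law:
  assumes "h \<in> borel_measurable (paths (Suc n))"
  shows "(\<integral>\<^sup>+x. h x \<partial>frozen_law Q \<mu>0 n y) =
    (\<integral>\<^sup>+x. ennreal (path_density \<pi> p n y x) * h x \<partial>reference (Suc n))"
  using assms
proof (induction n arbitrary: h)
  case 0
  have "(\<lambda>z. (\<lambda>_. undefined)(0 := z)) \<in> borel \<rightarrow>\<^sub>M (paths (Suc 0) :: (nat \<Rightarrow> 'x) measure)"
    by (rule measurable_fun_upd[where J="{}"]) (auto simp: space_PiM)
  then have m: "(\<lambda>z. h ((\<lambda>_. undefined)(0 := z))) \<in> borel_measurable borel"
    using 0 by (rule measurable_compose)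
  have "(\<integral>\<^sup>+x. h x \<partial>frozen_law Q \<mu>0 0 y) = (\<integral>\<^sup>+z. ennreal (\<pi> z) * h ((\<lambda>_. undefined)(0 := z)) \<partial>\<nu>)"
    unfolding nn_integral_frozen_law_0[OF 0]
    by (subst density_initial[symmetric], intro nn_integral_density) (use m in measurable)
  also have "\<dots> = (\<integral>\<^sup>+x. ennreal (path_density \<pi> p 0 y x) * h x \<partial>PiM (insert 0 {}) (\<lambda>_. \<nu>))"
    using 0 by (subst product_nn_integral_insert)
      (auto simp: product_nn_integral_insert PiM_empty nn_integral_count_space_finite path_density_def fun_upd_same
        simp del: fun_upd_apply intro!: borel_measurable_times_ennreal)
  finally show ?case by simp
next
  case (Suc n)
  define H where "H x = (\<integral>\<^sup>+z. ennreal (p (y n) (x n) z) * h (x(Suc n := z)) \<partial>\<nu>)" for x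
  have up: "(\<lambda>(x, z). x(Suc n := z)) \<in> paths (Suc n) \<Otimes>\<^sub>M borel \<rightarrow>\<^sub>M (paths (Suc (Suc n)) :: (nat \<Rightarrow> 'x) measure)"
    unfolding split_beta'
    by (rule measurable_fun_upd[where J="{0..<Suc n}"]) (auto simp: atLeast0_lessThan_Suc)
  have up2: "(\<lambda>(x, z). h (x(Suc n := z))) \<in> borel_measurable (paths (Suc n) \<Otimes>\<^sub>M borel)"
    using measurable_compose[OF up Suc.prems] by (simp only: split_beta')
  have sets: "sets (paths (Suc n) \<Otimes>\<^sub>M \<nu>) = sets (paths (Suc n) \<Otimes>\<^sub>M borel)"
    by (intro sets_pair_measure_cong) (auto simp: nu_borel)
  have Hm: "H \<in> borel_measurable (paths (Suc n))"
    unfolding H_def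
  proof (rule borel_measurable_nn_integral)
    show "(\<lambda>(x, z). ennreal (p (y n) (x n) z) * h (x(Suc n := z))) \<in> borel_measurable (paths (Suc n) \<Otimes>\<^sub>M \<nu>)"
      unfolding measurable_cong_sets[OF sets refl] split_beta'
      by (intro borel_measurable_times_ennreal measurable_ennreal measurable_p up2[unfolded split_beta']) auto
  qed
  have sec: "(\<lambda>z. h (x(Suc n := z))) \<in> borel_measurable borel" if "x \<in> space (paths (Suc n))" for x
    using measurable_Pair2[OF up2 that] by (simp only: prod.case)
  have "(\<integral>\<^sup>+x. h x \<partial>frozen_law Q \<mu>0 (Suc n) y) = (\<integral>\<^sup>+x. H x \<partial>frozen_law Q \<mu>0 n y)"
    unfolding nn_integral_frozen_law_Suc[OF Suc.prems] H_def
    by (intro nn_integral_cong nn_integral_kernel sec) (simp only: space_frozen_law)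
  also have "\<dots> = (\<integral>\<^sup>+x. ennreal (path_density \<pi> p n y x) * H x \<partial>reference (Suc n))"
    by (rule Suc.IH[OF Hm])
  also have "\<dots> = (\<integral>\<^sup>+x. \<integral>\<^sup>+z. ennreal (path_density \<pi> p (Suc n) y (x(Suc n := z))) * h (x(Suc n := z)) \<partial>\<nu> \<partial>reference (Suc n))"
  proof (rule nn_integral_cong)
    fix x assume "x \<in> space (reference (Suc n))"
    then have x: "x \<in> space (paths (Suc n))"
      using sets_eq_imp_space_eq[OF sets_reference] by simp
    have pd: "path_density \<pi> p (Suc n) y (x(Suc n := z)) = path_density \<pi> p n y x * p (y n) (x n) z" for z
      unfolding path_density_Suc using path_density_cong[of n y y "x(Suc n := z)" x] by simp
    show "ennreal (path_density \<pi> p n y x) * H x =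
      (\<integral>\<^sup>+z. ennreal (path_density \<pi> p (Suc n) y (x(Suc n := z))) * h (x(Suc n := z)) \<partial>\<nu>)"
      unfolding H_def pd ennreal_mult[OF path_density_nonneg p_nonneg] mult.assoc
      using sec[OF x] by (intro nn_integral_cmult[symmetric]) measurable
  qed
  also have "\<dots> = (\<integral>\<^sup>+x. ennreal (path_density \<pi> p (Suc n) y x) * h x \<partial>PiM (insert (Suc n) {0..<Suc n}) (\<lambda>_. \<nu>))"
    using Suc.prems by (intro product_nn_integral_insert[symmetric])
      (auto simp: atLeast0_lessThan_Suc[symmetric] simp del: fun_upd_apply intro!: borel_measurable_times_ennreal)
  also have "insert (Suc n) {0..<Suc n} = {0..<Suc (Suc n)}" by auto
  finally show ?case .
qed

text \<open>The bridge between the law that defines \<open>frozen_mean_sum\<close> and the model for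
  which the regularity hypotheses are formulated.\<close>

lemma frozen_law_eq_path_model: "frozen_law Q \<mu>0 n y = path_model \<nu> \<pi> p n y"
proof (rule measure_eqI)
  show "sets (frozen_law Q \<mu>0 n y) = sets (path_model \<nu> \<pi> p n y)"
    unfolding path_model_def sets_density sets_reference by (rule sets_frozen_law)
  fix A assume A: "A \<in> sets (frozen_law Q \<mu>0 n y)"
  then have A': "A \<in> sets (paths (Suc n))" by (simp only: sets_frozen_law)
  have "emeasure (frozen_law Q \<mu>0 n y) A = (\<integral>\<^sup>+x. indicator A x \<partial>frozen_law Q \<mu>0 n y)"
    using A by simp
  also have "\<dots> = (\<integral>\<^sup>+x. ennreal (path_density \<pi> p n y x) * indicator A x \<partial>reference (Suc n))"
    by (rule nn_integral_frozen_law[OF borel_measurable_indicator[OF A']])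
  also have "\<dots> = emeasure (path_model \<nu> \<pi> p n y) A"
    unfolding path_model_def using A' by (intro emeasure_density[symmetric]) (measurable, simp add: sets_reference)
  finally show "emeasure (frozen_law Q \<mu>0 n y) A = emeasure (path_model \<nu> \<pi> p n y) A" .
qed

end

section \<open>Scores\<close>

lemma differentiable_imp_GDERIV:
  fixes g :: "'a::euclidean_space \<Rightarrow> real"
  assumes "g differentiable (at v)"
  obtains D where "GDERIV g v :> D"
proof -
  obtain g' where g': "(g has_derivative g') (at v)"
    using assms by (auto simp: differentiable_def)
  then have "linear g'" by (rule has_derivative_linear)
  then have "g' = (\<lambda>h. h \<bullet> adjoint g' 1)"
    by (simp add: adjoint_works)
  then show thesis using g' that unfolding gderiv_def by metis
qed

text \<open>Meant for densities: a nonnegative function has gradient zero wherever it vanishes,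
  which handles the points where its logarithm has no derivative.\<close>

lemma GDERIV_minimum_eq_0:
  fixes g :: "'a::real_inner \<Rightarrow> real"
  assumes "GDERIV g v :> D" "\<And>w. g v \<le> g w"
  shows "D = 0"
proof -
  have "(\<lambda>h. h \<bullet> D) = (\<lambda>_. 0)"
    using differential_zero_maxmin[of v UNIV g] assms unfolding gderiv_def by blast
  then show ?thesis by (metis inner_eq_zero_iff)
qed

text \<open>Here \<open>c\<close> is the part of the path density that does not involve the varied
  parameter; under the logarithm it becomes an additive constant, so both logarithms have the same
  gradient.\<close>

lemma GDERIV_ln_mult:
  fixes q :: "'a::real_inner \<Rightarrow> real"
  assumes "GDERIV (\<lambda>w. c * q w) v :> D" "0 < c" "0 < q v"
  shows "GDERIV (\<lambda>w. ln (q w)) v :> D /\<^sub>R (c * q v)"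
    and "GDERIV (\<lambda>w. ln (c * q w)) v :> D /\<^sub>R (c * q v)"
proof -
  have d: "((\<lambda>w. c * q w) has_derivative (\<lambda>h. h \<bullet> D)) (at v)"
    using assms(1) by (simp add: gderiv_def)
  have "((\<lambda>w. inverse c * (c * q w)) has_derivative (\<lambda>h. inverse c * (h \<bullet> D))) (at v)"
    using d by (rule has_derivative_mult_right)
  then have "(q has_derivative (\<lambda>h. inverse c * (h \<bullet> D))) (at v)"
    using assms(2) by (simp add: mult.assoc[symmetric])
  from has_derivative_ln[OF assms(3) this]
  show "GDERIV (\<lambda>w. ln (q w)) v :> D /\<^sub>R (c * q v)"
    unfolding gderiv_def by (simp add: mult_ac)
  have "0 < c * q v" using assms by simp
  from has_derivative_ln[OF this d]
  show "GDERIV (\<lambda>w. ln (c * q w)) v :> D /\<^sub>R (c * q v)"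
    unfolding gderiv_def by (simp add: mult_ac)
qed

lemma borel_measurable_vec_nth [measurable (raw)]:
  fixes f :: "'a \<Rightarrow> real^'n"
  assumes "f \<in> borel_measurable N"
  shows "(\<lambda>x. f x $ i) \<in> borel_measurable N"
  using borel_measurable_inner[OF assms borel_measurable_const[of "axis i 1"]] by (simp add: inner_axis)

lemma vector_integrable_iff_component:
  fixes f :: "'a \<Rightarrow> real^'n"
  shows "integrable N f \<longleftrightarrow> (\<forall>i. integrable N (\<lambda>x. f x $ i))"
proof
  assume "integrable N f"
  then show "\<forall>i. integrable N (\<lambda>x. f x $ i)"
    by (auto intro: integrable_bounded_linear[OF bounded_linear_vec_nth])
next
  assume "\<forall>i. integrable N (\<lambda>x. f x $ i)"
  then have "integrable N (\<lambda>x. \<Sum>i\<in>UNIV. f x $ i *\<^sub>R axis i (1::real))"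
    by (intro Bochner_Integration.integrable_sum integrable_scaleR_left) auto
  then show "integrable N f"
    using basis_expansion[of "f _"] by (simp add: scalar_mult_eq_scaleR)
qed

text \<open>If \<open>f\<close> is not integrable and \<open>c\<close> is nonzero, both integrals
  take the default value 0.\<close>

lemma integral_scaleR_right_always:
  fixes f :: "'a \<Rightarrow> 'b::{banach, second_countable_topology}"
  shows "(\<integral>x. c *\<^sub>R f x \<partial>N) = c *\<^sub>R (\<integral>x. f x \<partial>N)"
proof (cases "c = 0 \<or> integrable N f")
  case False
  then have "\<not> integrable N (\<lambda>x. c *\<^sub>R f x)"
    using integrable_scaleR_right[of "inverse c" N "\<lambda>x. c *\<^sub>R f x"] by auto
  then show ?thesis using False by (simp add: not_integrable_integral_eq)
qed auto

section \<open>Scores as logarithmic derivatives and as martingale differences\<close>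

context regular_chain
begin

text \<open>Unlike \<open>path_score\<close>, it reads only two consecutive states and does not
  depend on the horizon; the two agree where the path density is positive.\<close>

definition score :: "(nat \<Rightarrow> real^'m) \<Rightarrow> nat \<Rightarrow> (nat \<Rightarrow> 'x) \<Rightarrow> real^'m" where
  "score y k x = transition_score p (y k) (x k) (x (Suc k))"

lemma measurable_transition_score:
  assumes "g \<in> N \<rightarrow>\<^sub>M borel" "h \<in> N \<rightarrow>\<^sub>M borel" "l \<in> N \<rightarrow>\<^sub>M borel"
  shows "(\<lambda>w. transition_score p (g w) (h w) (l w)) \<in> borel_measurable N"
  using measurable_compose[OF measurable_Pair[OF assms(1) measurable_Pair[OF assms(2,3)]] score_measurable]
  by (simp only: prod.case)

lemma score_measurable_paths [measurable]:
  assumes "k < n"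
  shows "score y k \<in> borel_measurable (paths (Suc n))"
  unfolding score_def[abs_def] using assms
  by (intro measurable_transition_score measurable_component_singleton measurable_const) auto

text \<open>The parameter \<open>y k\<close> enters only the factor with index \<open>Suc k\<close>.
  The constant \<open>c\<close> may be 0, and then the path density says nothing about the
  differentiability of that factor.\<close>

lemma path_density_split:
  assumes "k < n"
  obtains c where "0 \<le> c" "\<And>v. path_density \<pi> p n (y(k := v)) x = c * p v (x k) (x (Suc k))"
proof
  let ?c = "\<pi> (x 0) * (\<Prod>j\<in>{1..n} - {Suc k}. p (y (j - 1)) (x (j - 1)) (x j))"
  show "0 \<le> ?c" by (intro mult_nonneg_nonneg prod_nonneg) (auto simp: pi_nonneg p_nonneg)
  show "path_density \<pi> p n (y(k := v)) x = ?c * p v (x k) (x (Suc k))" for v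
  proof -
    have "(\<Prod>j\<in>{1..n}. p ((y(k := v)) (j - 1)) (x (j - 1)) (x j)) =
       p v (x k) (x (Suc k)) * (\<Prod>j\<in>{1..n} - {Suc k}. p ((y(k := v)) (j - 1)) (x (j - 1)) (x j))"
      using assms by (subst prod.remove[of _ "Suc k"]) auto
    also have "(\<Prod>j\<in>{1..n} - {Suc k}. p ((y(k := v)) (j - 1)) (x (j - 1)) (x j)) =
       (\<Prod>j\<in>{1..n} - {Suc k}. p (y (j - 1)) (x (j - 1)) (x j))"
      by (intro prod.cong) auto
    finally show ?thesis by (simp add: path_density_def)
  qed
qed

text \<open>Differentiability is given for the product, so the factor can be differentiated only
  where the density is positive. Where the density is 0 it is minimal, its gradient vanishes, and
  the first identity holds there too, whatever value \<open>score\<close> takes.\<close>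

lemma
  assumes "k < n"
  shows gradient_path_density:
      "gradient (\<lambda>v. path_density \<pi> p n (y(k := v)) x) (y k) = path_density \<pi> p n y x *\<^sub>R score y k x"
    and path_score_eq_score:
      "0 < path_density \<pi> p n y x \<Longrightarrow> path_score \<pi> p n y k x = score y k x"
proof -
  obtain c where c: "0 \<le> c" "\<And>v. path_density \<pi> p n (y(k := v)) x = c * p v (x k) (x (Suc k))"
    using path_density_split[OF assms] by metis
  from c(2)[of "y k"] have pd: "path_density \<pi> p n y x = c * p (y k) (x k) (x (Suc k))" by simp
  obtain D where D: "GDERIV (\<lambda>v. path_density \<pi> p n (y(k := v)) x) (y k) :> D"
    using density_differentiable[of n k y x] assms by (auto elim: differentiable_imp_GDERIV)
  have pos: "score y k x = D /\<^sub>R path_density \<pi> p n y x \<and> path_score \<pi> p n y k x = score y k x"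
    if "0 < path_density \<pi> p n y x"
  proof -
    have "0 < c" "0 < p (y k) (x k) (x (Suc k))"
      using that c(1) p_nonneg[of "y k" "x k" "x (Suc k)"] by (auto simp: pd zero_less_mult_iff)
    from GDERIV_ln_mult[OF D[unfolded c(2)] this]
    show ?thesis
      unfolding score_def transition_score_def path_score_def c(2) pd by (simp add: gradient_eq)
  qed
  then show "0 < path_density \<pi> p n y x \<Longrightarrow> path_score \<pi> p n y k x = score y k x" by simp
  have "D = path_density \<pi> p n y x *\<^sub>R score y k x"
  proof (cases "path_density \<pi> p n y x = 0")
    case True
    then have "D = 0"
      using GDERIV_minimum_eq_0[OF D] by (simp add: path_density_nonneg)
    then show ?thesis using True by simp
  next
    case False
    then show ?thesis using pos path_density_nonneg[of n y x] by simp
  qed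
  then show "gradient (\<lambda>v. path_density \<pi> p n (y(k := v)) x) (y k) = path_density \<pi> p n y x *\<^sub>R score y k x"
    using gradient_eq[OF D] by simp
qed

lemma AE_frozen_law_density_pos: "AE x in frozen_law Q \<mu>0 n y. 0 < path_density \<pi> p n y x"
  unfolding frozen_law_eq_path_model path_model_def
  by (subst AE_density) (auto simp: measurable_cong_sets[OF sets_reference refl] intro!: measurable_ennreal)

lemma integral_frozen_law:
  fixes h :: "(nat \<Rightarrow> 'x) \<Rightarrow> 'b::{banach, second_countable_topology}"
  assumes "h \<in> borel_measurable (paths (Suc n))"
  shows "(\<integral>x. h x \<partial>frozen_law Q \<mu>0 n y) = (\<integral>x. path_density \<pi> p n y x *\<^sub>R h x \<partial>reference (Suc n))"
    and "integrable (frozen_law Q \<mu>0 n y) h \<longleftrightarrow>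
      integrable (reference (Suc n)) (\<lambda>x. path_density \<pi> p n y x *\<^sub>R h x)"
proof -
  have m: "h \<in> borel_measurable (reference (Suc n))"
    "path_density \<pi> p n y \<in> borel_measurable (reference (Suc n))"
    using assms by (auto simp: measurable_cong_sets[OF sets_reference refl])
  show "(\<integral>x. h x \<partial>frozen_law Q \<mu>0 n y) = (\<integral>x. path_density \<pi> p n y x *\<^sub>R h x \<partial>reference (Suc n))"
    unfolding frozen_law_eq_path_model path_model_def
    by (rule integral_density[OF m]) (simp add: path_density_nonneg)
  show "integrable (frozen_law Q \<mu>0 n y) h \<longleftrightarrow>
      integrable (reference (Suc n)) (\<lambda>x. path_density \<pi> p n y x *\<^sub>R h x)"
    unfolding frozen_law_eq_path_model path_model_def
    by (rule integrable_density[OF m]) (simp add: path_density_nonneg)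
qed

lemma borel_measurable_frozen_law:
  "h \<in> borel_measurable (frozen_law Q \<mu>0 n y) \<longleftrightarrow> h \<in> borel_measurable (paths (Suc n))"
  by (simp only: measurable_cong_sets[OF sets_frozen_law refl])

text \<open>Finiteness of the Fisher information concerns \<open>path_score\<close>; it passes to
  \<open>score\<close> because the path density is positive almost everywhere under its own
  law.\<close>

lemma integrable_score_product:
  assumes "j < n" "k < n"
  shows "integrable (frozen_law Q \<mu>0 n y) (\<lambda>x. score y j x $ i * score y k x $ i')"
proof -
  let ?P = "frozen_law Q \<mu>0 n y"
  have "integrable ?P (\<lambda>x. path_score \<pi> p n y j x $ i * path_score \<pi> p n y k x $ i')"
    using fisher_finite[of n "(j, i)" "(k, i')" y] assms by (simp add: frozen_law_eq_path_model)
  moreover have "AE x in ?P. path_score \<pi> p n y j x $ i * path_score \<pi> p n y k x $ i' =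
      score y j x $ i * score y k x $ i'"
    using AE_frozen_law_density_pos by eventually_elim (simp add: path_score_eq_score assms)
  moreover have "(\<lambda>x. score y j x $ i * score y k x $ i') \<in> borel_measurable ?P"
    unfolding borel_measurable_frozen_law using assms by measurable
  ultimately show ?thesis
    using integrable_cong_AE borel_measurable_integrable by blast
qed

text \<open>
  The score of a transition is a martingale difference: given \<open>x\<^sub>0, \<dots>, x\<^sub>k\<close> its conditional mean is the
  derivative of the constant \<open>v \<mapsto> \<integral> p v x\<^sub>k z dz\<close>.
\<close>

lemma integral_last_score:
  assumes a: "a \<in> borel_measurable (paths (Suc (Suc k)))" "\<And>x z. a (x(Suc k := z)) = a x"
    and int: "integrable (frozen_law Q \<mu>0 (Suc k) y) (\<lambda>x. a x *\<^sub>R score y k x)"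
  shows "(\<integral>x. a x *\<^sub>R score y k x \<partial>frozen_law Q \<mu>0 (Suc k) y) = 0"
proof -
  define g where "g x = path_density \<pi> p (Suc k) y x *\<^sub>R (a x *\<^sub>R score y k x)" for x
  have m: "(\<lambda>x. a x *\<^sub>R score y k x) \<in> borel_measurable (paths (Suc (Suc k)))"
    using a(1) by measurable
  have one: "1 \<le> Suc k" by simp
  have ins: "{0..<Suc (Suc k)} = insert (Suc k) {0..<Suc k}" by auto
  have "integrable (PiM (insert (Suc k) {0..<Suc k}) (\<lambda>_. \<nu>)) g"
    using int unfolding integral_frozen_law(2)[OF m] g_def by (simp only: ins)
  then have "(\<integral>x. g x \<partial>reference (Suc (Suc k))) = (\<integral>x. \<integral>z. g (x(Suc k := z)) \<partial>\<nu> \<partial>reference (Suc k))"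
    unfolding ins by (intro product_integral_insert) auto
  also have "\<dots> = 0"
  proof (rule integral_eq_zero_AE)
    show "AE x in reference (Suc k). (\<integral>z. g (x(Suc k := z)) \<partial>\<nu>) = 0"
      using interchange_conditional_density[OF one lessI, of y]
    proof eventually_elim
      case (elim x)
      have pd: "path_density \<pi> p (Suc k) (y(k := v)) (x(Suc k := z)) = path_density \<pi> p k y x * p v (x k) z" for v z
        unfolding path_density_Suc using path_density_cong[of k "y(k := v)" y "x(Suc k := z)" x] by simp
      \<comment> \<open>By \<open>integral_p\<close> the inner integral is constant in
        \<open>v\<close>. Uniqueness of gradients then forces the interchanged integral to be
        0.\<close>
      have "GDERIV (\<lambda>v. \<integral>z. path_density \<pi> p (Suc k) (y(k := v)) (x(Suc k := z)) \<partial>\<nu>) (y k) :> 0"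
        unfolding pd by (simp add: integral_p GDERIV_const)
      from trans[OF gradient_eq[OF elim, symmetric] gradient_eq[OF this]]
      have "(\<integral>z. gradient (\<lambda>v. path_density \<pi> p (Suc k) (y(k := v)) (x(Suc k := z))) (y k) \<partial>\<nu>) = 0" .
      then have "a x *\<^sub>R (\<integral>z. path_density \<pi> p (Suc k) y (x(Suc k := z)) *\<^sub>R score y k (x(Suc k := z)) \<partial>\<nu>) = 0"
        by (simp only: gradient_path_density[OF lessI] scaleR_zero_right)
      \<comment> \<open>The weight \<open>a\<close> does not see the coordinate
        \<open>Suc k\<close>, so it leaves the inner integral as a constant.\<close>
      then show ?case
        unfolding g_def a(2) by (simp only: scaleR_left_commute integral_scaleR_right_always[symmetric])
    qed
  qed
  finally show ?thesis
    unfolding integral_frozen_law(1)[OF m] g_def by simp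
qed

text \<open>Weight and score depend on the coordinates 0, ..., k + 1 only, so passing to the
  marginal makes transition k the last one. The hypothesis \<open>local\<close> says this for
  \<open>a\<close>, since truncation overwrites later coordinates by
  \<open>undefined\<close>.\<close>

lemma integral_score:
  assumes a: "a \<in> borel_measurable (paths (Suc (Suc k)))" "\<And>x z. a (x(Suc k := z)) = a x"
    and local: "\<And>x. a (restrict x {0..<Suc (Suc k)}) = a x"
    and "k < n" and int: "integrable (frozen_law Q \<mu>0 n y) (\<lambda>x. a x *\<^sub>R score y k x)"
  shows "(\<integral>x. a x *\<^sub>R score y k x \<partial>frozen_law Q \<mu>0 n y) = 0"
proof -
  let ?r = "\<lambda>x. restrict x {0..<Suc (Suc k)}" and ?P = "frozen_law Q \<mu>0 n y"
  let ?h = "\<lambda>x. a x *\<^sub>R score y k x"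
  have marg: "frozen_law Q \<mu>0 (Suc k) y = distr ?P (paths (Suc (Suc k))) ?r"
    using \<open>k < n\<close> by (intro frozen_law_marginal) simp
  have h: "?h (?r x) = ?h x" for x
    by (simp only: local) (simp add: score_def)
  have m: "?h \<in> borel_measurable (paths (Suc (Suc k)))"
    using a(1) by measurable
  have r: "?r \<in> ?P \<rightarrow>\<^sub>M paths (Suc (Suc k))"
    unfolding measurable_cong_sets[OF sets_frozen_law refl]
    using \<open>k < n\<close> by (intro measurable_restrict_subset) auto
  have "integrable (frozen_law Q \<mu>0 (Suc k) y) ?h"
    unfolding marg integrable_distr_eq[OF r m] h by (rule int)
  from integral_last_score[OF a this] show ?thesis
    unfolding marg integral_distr[OF r m] h .
qed

end

section \<open>The Cramer-Rao inequality for a frozen environment\<close>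

lemma integrable_mult_if_square_integrable:
  fixes g h :: "'a \<Rightarrow> real"
  assumes "g \<in> borel_measurable N" "h \<in> borel_measurable N"
    and "integrable N (\<lambda>x. (g x)\<^sup>2)" "integrable N (\<lambda>x. (h x)\<^sup>2)"
  shows "integrable N (\<lambda>x. g x * h x)"
proof (rule Bochner_Integration.integrable_bound)
  show "integrable N (\<lambda>x. (g x)\<^sup>2 + (h x)\<^sup>2)" using assms by simp
  show "AE x in N. norm (g x * h x) \<le> norm ((g x)\<^sup>2 + (h x)\<^sup>2)"
  proof (rule AE_I2)
    fix x
    have "2 * (\<bar>g x\<bar> * \<bar>h x\<bar>) \<le> (g x)\<^sup>2 + (h x)\<^sup>2"
      using zero_le_power2[of "\<bar>g x\<bar> - \<bar>h x\<bar>"] by (simp add: power2_diff mult.assoc)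
    moreover have "0 \<le> \<bar>g x\<bar> * \<bar>h x\<bar>" by simp
    ultimately have "\<bar>g x\<bar> * \<bar>h x\<bar> \<le> (g x)\<^sup>2 + (h x)\<^sup>2" by linarith
    then show "norm (g x * h x) \<le> norm ((g x)\<^sup>2 + (h x)\<^sup>2)" by (simp add: abs_mult)
  qed
qed (use assms in measurable)

text \<open>Expanding the square of \<open>g - z\<close> keeps the second moment of \<open>z\<close>
  out of denominators, so a vanishing \<open>z\<close> is not a special case.\<close>

lemma nn_integral_square_ge:
  fixes g z :: "'a \<Rightarrow> real"
  assumes "g \<in> borel_measurable N" "z \<in> borel_measurable N"
    and g2: "integrable N (\<lambda>x. (g x)\<^sup>2)" and z2: "integrable N (\<lambda>x. (z x)\<^sup>2)"
    and cov: "(\<integral>x. g x * z x \<partial>N) = T" and var: "(\<integral>x. (z x)\<^sup>2 \<partial>N) \<le> T"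
  shows "ennreal T \<le> (\<integral>\<^sup>+x. ennreal ((g x)\<^sup>2) \<partial>N)"
proof -
  have gz: "integrable N (\<lambda>x. g x * z x)"
    using assms by (intro integrable_mult_if_square_integrable)
  have "0 \<le> (\<integral>x. (g x - z x)\<^sup>2 \<partial>N)" by simp
  also have "(\<lambda>x. (g x - z x)\<^sup>2) = (\<lambda>x. (g x)\<^sup>2 - 2 * (g x * z x) + (z x)\<^sup>2)"
    by (auto simp: power2_diff)
  also have "(\<integral>x. \<dots> x \<partial>N) = (\<integral>x. (g x)\<^sup>2 \<partial>N) - 2 * T + (\<integral>x. (z x)\<^sup>2 \<partial>N)"
    using g2 z2 gz by (simp add: cov)
  finally have "T \<le> (\<integral>x. (g x)\<^sup>2 \<partial>N)" using var by simp
  then show ?thesis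
    by (simp add: nn_integral_eq_integral[OF g2] ennreal_leI)
qed

context regular_chain
begin

abbreviation law :: "nat \<Rightarrow> (nat \<Rightarrow> real^'m) \<Rightarrow> (nat \<Rightarrow> 'x) measure" where
  "law \<equiv> frozen_law Q \<mu>0"

abbreviation path_sum :: "nat \<Rightarrow> (nat \<Rightarrow> 'x) \<Rightarrow> real" where
  "path_sum n x \<equiv> \<Sum>k=1..n. \<Phi> (x k)"

definition mean_gradient :: "nat \<Rightarrow> (nat \<Rightarrow> real^'m) \<Rightarrow> nat \<Rightarrow> real^'m" where
  "mean_gradient n y k = gradient (\<lambda>v. frozen_mean_sum Q \<mu>0 \<Phi> n (y(k := v))) (y k)"

text \<open>Taken at horizon \<open>n\<close> rather than \<open>k + 1\<close>, to match
  \<open>cond_fisher\<close>, which conditions on all of Y_0, ..., Y_(n-1).\<close>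

definition frozen_fisher :: "nat \<Rightarrow> (nat \<Rightarrow> real^'m) \<Rightarrow> nat \<Rightarrow> real^'m^'m" where
  "frozen_fisher n y k = (\<chi> i j. \<integral>x. score y k x $ i * score y k x $ j \<partial>frozen_law Q \<mu>0 n y)"

context
  fixes n :: nat and y :: "nat \<Rightarrow> real^'m"
begin

interpretation P: prob_space "law n y"
  by (rule prob_space_frozen_law)

lemma Phi_paths: "l \<le> n \<Longrightarrow> (\<lambda>x. \<Phi> (x l)) \<in> borel_measurable (paths (Suc n))"
  using measurable_compose[OF measurable_component_singleton[of l "{0..<Suc n}" "\<lambda>_. borel"] Phi_measurable]
  by simp

lemma sum_Phi_paths: "path_sum n \<in> borel_measurable (paths (Suc n))"
  by (intro borel_measurable_sum Phi_paths) simp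

lemma integrable_Phi_square: "l \<in> {1..n} \<Longrightarrow> integrable (law n y) (\<lambda>x. (\<Phi> (x l))\<^sup>2)"
  using estimator_square_integrable[of n l y] by (simp add: frozen_law_eq_path_model)

lemma integrable_Phi: "l \<in> {1..n} \<Longrightarrow> integrable (law n y) (\<lambda>x. \<Phi> (x l))"
  using P.square_integrable_imp_integrable[OF _ integrable_Phi_square] Phi_paths[of l]
  by (simp add: borel_measurable_frozen_law)

text \<open>A statement about each frozen law separately; it does not carry over to the law of the
  sum under \<open>M\<close>.\<close>

lemma integrable_sum_Phi_square: "integrable (law n y) (\<lambda>x. (path_sum n x - c)\<^sup>2)"
proof -
  have "integrable (law n y) (\<lambda>x. \<Phi> (x l) * \<Phi> (x l'))" if "l \<in> {1..n}" "l' \<in> {1..n}" for l l'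
    using that by (intro integrable_mult_if_square_integrable integrable_Phi_square)
      (auto simp only: borel_measurable_frozen_law intro!: Phi_paths, auto)
  then have "integrable (law n y) (\<lambda>x. \<Sum>l=1..n. \<Sum>l'=1..n. \<Phi> (x l) * \<Phi> (x l'))"
    by (intro Bochner_Integration.integrable_sum)
  then have "integrable (law n y) (\<lambda>x. (path_sum n x)\<^sup>2)"
    by (simp add: power2_eq_square sum_product)
  moreover have "integrable (law n y) (path_sum n)"
    by (intro Bochner_Integration.integrable_sum integrable_Phi)
  ultimately show ?thesis
    by (simp add: power2_diff)
qed

text \<open>Brings the mean into the form in which differentiation under the integral is assumed,
  term by term. Closing the context generalises it over \<open>y\<close>, so it applies at every
  perturbed environment \<open>y(k := v)\<close>.\<close>

lemma frozen_mean_sum_eq: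
  "frozen_mean_sum Q \<mu>0 \<Phi> n y = (\<Sum>l=1..n. \<integral>x. \<Phi> (x l) * path_density \<pi> p n y x \<partial>reference (Suc n))"
proof -
  have "frozen_mean_sum Q \<mu>0 \<Phi> n y = (\<Sum>l=1..n. \<integral>x. \<Phi> (x l) \<partial>law n y)"
    unfolding frozen_mean_sum_def by (intro Bochner_Integration.integral_sum integrable_Phi)
  also have "\<dots> = (\<Sum>l=1..n. \<integral>x. \<Phi> (x l) * path_density \<pi> p n y x \<partial>reference (Suc n))"
    by (intro sum.cong refl, subst integral_frozen_law(1)) (auto intro!: Phi_paths simp: mult.commute)
  finally show ?thesis .
qed

end

context
  fixes n :: nat and y :: "nat \<Rightarrow> real^'m"
begin

interpretation P: prob_space "law n y"
  by (rule prob_space_frozen_law)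

lemma score_inner_square_integrable:
  assumes "k < n"
  shows "integrable (law n y) (\<lambda>x. (a \<bullet> score y k x)\<^sup>2)"
proof -
  have "(a \<bullet> score y k x)\<^sup>2 = (\<Sum>i\<in>UNIV. \<Sum>j\<in>UNIV. (a $ i * a $ j) * (score y k x $ i * score y k x $ j))" for x
    by (simp add: inner_vec_def power2_eq_square sum_product mult_ac)
  then show ?thesis
    by (simp only:) (intro Bochner_Integration.integrable_sum integrable_mult_right integrable_score_product assms)
qed

lemma integrable_mult_score:
  assumes "k < n" "g \<in> borel_measurable (paths (Suc n))" "integrable (law n y) (\<lambda>x. (g x)\<^sup>2)"
  shows "integrable (law n y) (\<lambda>x. g x *\<^sub>R score y k x)"
  unfolding vector_integrable_iff_component
proof
  fix i
  have "integrable (law n y) (\<lambda>x. (score y k x $ i)\<^sup>2)"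
    using integrable_score_product[OF assms(1,1)] by (simp add: power2_eq_square)
  then have "integrable (law n y) (\<lambda>x. g x * score y k x $ i)"
    using assms
    by (intro integrable_mult_if_square_integrable) (auto simp: borel_measurable_frozen_law)
  then show "integrable (law n y) (\<lambda>x. (g x *\<^sub>R score y k x) $ i)" by simp
qed

text \<open>Differentiating the density produces the factor \<open>score\<close>. Since the score is
  centred, any constant may be subtracted from the sum, in particular one that does not depend on
  the environment.\<close>

lemma mean_gradient_eq:
  assumes k: "k < n"
  shows "mean_gradient n y k = (\<integral>x. (path_sum n x - c) *\<^sub>R score y k x \<partial>law n y)"
proof -
  let ?d = "\<lambda>v. path_density \<pi> p n (y(k := v))"
  have int: "integrable (law n y) (\<lambda>x. \<Phi> (x l) *\<^sub>R score y k x)" if "l \<in> {1..n}" for l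
    using that by (intro integrable_mult_score k Phi_paths integrable_Phi_square) auto
  have D: "GDERIV (\<lambda>v. \<integral>x. \<Phi> (x l) * ?d v x \<partial>reference (Suc n)) (y k) :> (\<integral>x. \<Phi> (x l) *\<^sub>R score y k x \<partial>law n y)"
    if l: "l \<in> {1..n}" for l
  proof -
    have "(\<lambda>x. \<Phi> (x l) *\<^sub>R score y k x) \<in> borel_measurable (paths (Suc n))"
      using Phi_paths[of l] score_measurable_paths[OF k, of y] l by (intro borel_measurable_scaleR) auto
    then have "(\<integral>x. \<Phi> (x l) *\<^sub>R gradient (\<lambda>v. ?d v x) (y k) \<partial>reference (Suc n)) = (\<integral>x. \<Phi> (x l) *\<^sub>R score y k x \<partial>law n y)"
      unfolding gradient_path_density[OF k] by (subst integral_frozen_law(1)) (simp_all add: mult.commute)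
    then show ?thesis using interchange_estimator[of n k l y] k l by simp
  qed
  have "GDERIV (\<lambda>v. \<Sum>l=1..n. \<integral>x. \<Phi> (x l) * ?d v x \<partial>reference (Suc n)) (y k)
      :> (\<Sum>l=1..n. \<integral>x. \<Phi> (x l) *\<^sub>R score y k x \<partial>law n y)"
    using D unfolding gderiv_def inner_sum_right by (intro has_derivative_sum) auto
  moreover have "(\<Sum>l=1..n. \<integral>x. \<Phi> (x l) *\<^sub>R score y k x \<partial>law n y) = (\<integral>x. path_sum n x *\<^sub>R score y k x \<partial>law n y)"
    unfolding scaleR_sum_left using int by (intro Bochner_Integration.integral_sum[symmetric])
  moreover have "(\<integral>x. (path_sum n x - c) *\<^sub>R score y k x \<partial>law n y) = (\<integral>x. path_sum n x *\<^sub>R score y k x \<partial>law n y) - c *\<^sub>R (\<integral>x. score y k x \<partial>law n y)"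
  proof -
    have "integrable (law n y) (\<lambda>x. path_sum n x *\<^sub>R score y k x)"
      unfolding scaleR_sum_left using int by (intro Bochner_Integration.integrable_sum)
    moreover have "integrable (law n y) (score y k)"
      using integrable_mult_score[OF k, of "\<lambda>_. 1"] by simp
    ultimately show ?thesis
      unfolding scaleR_diff_left by (subst Bochner_Integration.integral_diff) (auto simp: integral_scaleR_right_always)
  qed
  moreover have "(\<integral>x. score y k x \<partial>law n y) = 0"
    using integral_score[of "\<lambda>_. 1" k n y] k integrable_mult_score[OF k, of "\<lambda>_. 1"] by simp
  ultimately show ?thesis
    unfolding mean_gradient_def frozen_mean_sum_eq by (simp only: gradient_eq scaleR_zero_right diff_zero)
qed

lemma fisher_form:
  assumes "k < n"
  shows "(\<integral>x. (a \<bullet> score y k x)\<^sup>2 \<partial>law n y) = a \<bullet> (frozen_fisher n y k *v a)"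
proof -
  have "(a \<bullet> score y k x)\<^sup>2 = (\<Sum>i\<in>UNIV. \<Sum>j\<in>UNIV. (a $ i * a $ j) * (score y k x $ i * score y k x $ j))" for x
    by (simp add: inner_vec_def power2_eq_square sum_product mult_ac)
  then have "(\<integral>x. (a \<bullet> score y k x)\<^sup>2 \<partial>law n y) =
     (\<Sum>i\<in>UNIV. \<Sum>j\<in>UNIV. (a $ i * a $ j) * (\<integral>x. score y k x $ i * score y k x $ j \<partial>law n y))"
    by (simp only:) (simp add: integrable_score_product assms Bochner_Integration.integral_sum)
  also have "\<dots> = a \<bullet> (frozen_fisher n y k *v a)"
    by (simp add: inner_vec_def matrix_vector_mult_def frozen_fisher_def sum_distrib_left mult_ac)
  finally show ?thesis .
qed

lemma transpose_frozen_fisher: "transpose (frozen_fisher n y k) = frozen_fisher n y k"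
  by (simp add: transpose_def frozen_fisher_def vec_eq_iff mult.commute)

text \<open>The earlier score reads the states at j and j + 1, and j + 1 is at most k, so it is an
  admissible weight for the martingale difference of transition k.\<close>

lemma score_orthogonal:
  assumes "j < k" "k < n"
  shows "(\<integral>x. (a \<bullet> score y j x) * (b \<bullet> score y k x) \<partial>law n y) = 0"
proof -
  let ?a = "\<lambda>x. a \<bullet> score y j x"
  have m: "?a \<in> borel_measurable (paths (Suc n))" "?a \<in> borel_measurable (paths (Suc (Suc k)))"
    using assms by (auto intro!: borel_measurable_inner)
  have int: "integrable (law n y) (\<lambda>x. ?a x *\<^sub>R score y k x)"
    using assms by (intro integrable_mult_score score_inner_square_integrable m) auto
  have "(\<integral>x. ?a x *\<^sub>R score y k x \<partial>law n y) = 0"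
    using assms int by (intro integral_score m) (auto simp: score_def)
  then have "0 = b \<bullet> (\<integral>x. ?a x *\<^sub>R score y k x \<partial>law n y)" by simp
  also have "\<dots> = (\<integral>x. b \<bullet> (?a x *\<^sub>R score y k x) \<partial>law n y)"
    using int by (intro integral_inner_right[symmetric])
  finally show ?thesis by simp
qed

text \<open>
  The Cramer-Rao inequality is obtained by testing against the combination of scores with
  coefficients \<open>b\<^sub>k / r\<^sub>k\<close>, which makes inverting the Fisher information unnecessary.
\<close>

lemma frozen_cramer_rao:
  "ennreal (\<Sum>k<n. 1 / matrix_spectral_radius (frozen_fisher n y k) * (norm (mean_gradient n y k))\<^sup>2)
    \<le> (\<integral>\<^sup>+x. ennreal ((path_sum n x - c)\<^sup>2) \<partial>law n y)"
proof -
  define r where "r k = matrix_spectral_radius (frozen_fisher n y k)" for k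
  define b where "b k = mean_gradient n y k" for k
  define a where "a k = (1 / r k) *\<^sub>R b k" for k
  define z where "z k x = a k \<bullet> score y k x" for k x
  let ?Z = "\<lambda>x. \<Sum>k<n. z k x"
  let ?T = "\<Sum>k<n. 1 / r k * (norm (b k))\<^sup>2"
  have zm: "z k \<in> borel_measurable (law n y)" if "k < n" for k
    unfolding borel_measurable_frozen_law z_def[abs_def] using that by (intro borel_measurable_inner) auto
  have z2: "integrable (law n y) (\<lambda>x. (z k x)\<^sup>2)" if "k < n" for k
    unfolding z_def by (rule score_inner_square_integrable[OF that])
  have zz: "integrable (law n y) (\<lambda>x. z j x * z k x)" if "j < n" "k < n" for j k
    using that by (intro integrable_mult_if_square_integrable zm z2)
  have Zsq: "(?Z x)\<^sup>2 = (\<Sum>j<n. \<Sum>k<n. z j x * z k x)" for x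
    by (simp add: power2_eq_square sum_product)
  have Sm: "(\<lambda>x. path_sum n x - c) \<in> borel_measurable (paths (Suc n))"
    by (intro borel_measurable_diff sum_Phi_paths borel_measurable_const)
  have "ennreal ?T \<le> (\<integral>\<^sup>+x. ennreal ((path_sum n x - c)\<^sup>2) \<partial>law n y)"
  proof (rule nn_integral_square_ge[where z="?Z"])
    show "(\<lambda>x. path_sum n x - c) \<in> borel_measurable (law n y)"
      unfolding borel_measurable_frozen_law by (rule Sm)
    show "?Z \<in> borel_measurable (law n y)" using zm by (intro borel_measurable_sum) auto
    show "integrable (law n y) (\<lambda>x. (path_sum n x - c)\<^sup>2)" by (rule integrable_sum_Phi_square)
    show "integrable (law n y) (\<lambda>x. (?Z x)\<^sup>2)"
      unfolding Zsq using zz by (intro Bochner_Integration.integrable_sum) auto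
    have Sz: "integrable (law n y) (\<lambda>x. (path_sum n x - c) *\<^sub>R score y k x)" if "k < n" for k
      by (rule integrable_mult_score[OF that Sm integrable_sum_Phi_square])
    have "(\<integral>x. (path_sum n x - c) * z k x \<partial>law n y) = 1 / r k * (norm (b k))\<^sup>2" if "k < n" for k
    proof -
      have "(\<integral>x. (path_sum n x - c) * z k x \<partial>law n y) = (\<integral>x. a k \<bullet> ((path_sum n x - c) *\<^sub>R score y k x) \<partial>law n y)"
        by (simp add: z_def)
      also have "\<dots> = a k \<bullet> b k"
        unfolding b_def mean_gradient_eq[OF that, of c] using Sz[OF that] by (intro integral_inner_right)
      finally show ?thesis by (simp add: a_def power2_norm_eq_inner)
    qed
    moreover have "integrable (law n y) (\<lambda>x. (path_sum n x - c) * z k x)" if "k < n" for k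
      using integrable_inner_right[OF Sz[OF that], of "a k"] by (simp add: z_def)
    ultimately show "(\<integral>x. (path_sum n x - c) * ?Z x \<partial>law n y) = ?T"
      by (simp add: sum_distrib_left Bochner_Integration.integral_sum)
    have off: "(\<integral>x. z j x * z k x \<partial>law n y) = 0" if "j < n" "k < n" "j \<noteq> k" for j k
      using that score_orthogonal[of j k "a j" "a k"] score_orthogonal[of k j "a k" "a j"]
      by (cases "j < k") (auto simp: z_def mult.commute)
    have "(\<integral>x. (?Z x)\<^sup>2 \<partial>law n y) = (\<Sum>j<n. \<Sum>k<n. \<integral>x. z j x * z k x \<partial>law n y)"
      unfolding Zsq using zz
      by (subst Bochner_Integration.integral_sum)
        (auto intro!: sum.cong Bochner_Integration.integral_sum Bochner_Integration.integrable_sum)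
    also have "\<dots> = (\<Sum>j<n. \<Sum>k<n. if k = j then \<integral>x. (z k x)\<^sup>2 \<partial>law n y else 0)"
      using off by (intro sum.cong refl) (auto simp: power2_eq_square)
    also have "\<dots> = (\<Sum>k<n. \<integral>x. (z k x)\<^sup>2 \<partial>law n y)" by simp
    also have "\<dots> \<le> ?T"
    proof (rule sum_mono)
      fix k assume "k \<in> {..<n}"
      then have "(\<integral>x. (z k x)\<^sup>2 \<partial>law n y) = a k \<bullet> (frozen_fisher n y k *v a k)"
        unfolding z_def by (simp add: fisher_form)
      also have "\<dots> \<le> r k * (norm (a k))\<^sup>2"
        unfolding r_def by (rule matrix_spectral_radius_symmetric(1)[OF transpose_frozen_fisher])
      \<comment> \<open>If \<open>r k = 0\<close>, division by zero gives \<open>a k = 0\<close>,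
        and both sides are 0.\<close>
      also have "\<dots> = 1 / r k * (norm (b k))\<^sup>2"
        by (simp add: a_def power_mult_distrib power2_eq_square)
      finally show "(\<integral>x. (z k x)\<^sup>2 \<partial>law n y) \<le> 1 / r k * (norm (b k))\<^sup>2" .
    qed
    finally show "(\<integral>x. (?Z x)\<^sup>2 \<partial>law n y) \<le> ?T" .
  qed
  then show ?thesis by (simp add: r_def b_def)
qed

end

end

section \<open>Disintegration along the environment\<close>

text \<open>Turns independence of set systems into a product law for variables whose preimages lie
  in them. It is applied first to environment and noise, then to the start and that pair.\<close>

lemma (in prob_space) distr_Pair_indep_set:
  assumes indep: "indep_set \<A> \<B>"
    and X: "X \<in> M \<rightarrow>\<^sub>M S" "\<And>A. A \<in> sets S \<Longrightarrow> X -` A \<inter> space M \<in> \<A>"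
    and Y: "Y \<in> M \<rightarrow>\<^sub>M T" "\<And>B. B \<in> sets T \<Longrightarrow> Y -` B \<inter> space M \<in> \<B>"
  shows "distr M S X \<Otimes>\<^sub>M distr M T Y = distr M (S \<Otimes>\<^sub>M T) (\<lambda>\<omega>. (X \<omega>, Y \<omega>))"
proof (rule pair_measure_eqI)
  show "sigma_finite_measure (distr M S X)" "sigma_finite_measure (distr M T Y)"
    using X(1) Y(1) by (auto intro!: prob_space_distr prob_space_imp_sigma_finite)
  show "sets (distr M S X \<Otimes>\<^sub>M distr M T Y) = sets (distr M (S \<Otimes>\<^sub>M T) (\<lambda>\<omega>. (X \<omega>, Y \<omega>)))"
    unfolding sets_distr by (intro sets_pair_measure_cong) simp_all
  fix A B assume "A \<in> sets (distr M S X)" "B \<in> sets (distr M T Y)"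
  then have A: "A \<in> sets S" and B: "B \<in> sets T" by simp_all
  have "(\<lambda>\<omega>. (X \<omega>, Y \<omega>)) -` (A \<times> B) \<inter> space M = (X -` A \<inter> space M) \<inter> (Y -` B \<inter> space M)"
    by auto
  then show "emeasure (distr M S X) A * emeasure (distr M T Y) B =
      emeasure (distr M (S \<Otimes>\<^sub>M T) (\<lambda>\<omega>. (X \<omega>, Y \<omega>))) (A \<times> B)"
    using indep_setD[OF indep X(2)[OF A] Y(2)[OF B]] X(1) Y(1) A B
    by (simp add: emeasure_distr emeasure_eq_measure ennreal_mult)
qed

section \<open>The chain as a function of independent start, environment and noise\<close>

locale independent_start_chain = random_environment_chain M f Y eps X
  for M :: "'w measure"
    and f :: "'x::polish_space \<Rightarrow> real^'m \<Rightarrow> real \<Rightarrow> 'x" and Y eps X +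
  assumes initial_indep:
    "indep_set
       (sets (vimage_algebra (space M) (X 0) borel))
       (sets (vimage_algebra (space M) (\<lambda>\<omega>. (\<lambda>i. Y i \<omega>, \<lambda>i. eps (Suc i) \<omega>))
         (PiM UNIV (\<lambda>_. borel) \<Otimes>\<^sub>M PiM UNIV (\<lambda>_. unit_uniform))))"
begin

sublocale random_map f
  using f_measurable by unfold_locales

declare Y_measurable [measurable] eps_measurable [measurable] X_initial [measurable]

abbreviation environments :: "nat \<Rightarrow> (nat \<Rightarrow> real^'m) measure" where
  "environments n \<equiv> PiM {..<n} (\<lambda>_. borel)"

abbreviation noises :: "nat \<Rightarrow> (nat \<Rightarrow> real) measure" where
  "noises n \<equiv> PiM {..<n} (\<lambda>_. unit_uniform)"

abbreviation initial_law :: "'x measure" where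
  "initial_law \<equiv> distr M borel (X 0)"

abbreviation law :: "nat \<Rightarrow> (nat \<Rightarrow> real^'m) \<Rightarrow> (nat \<Rightarrow> 'x) measure" where
  "law \<equiv> frozen_law (param_kernel f) initial_law"

definition environment :: "nat \<Rightarrow> 'w \<Rightarrow> nat \<Rightarrow> real^'m" where
  "environment n \<omega> = (\<lambda>i\<in>{..<n}. Y i \<omega>)"

definition noise :: "nat \<Rightarrow> 'w \<Rightarrow> nat \<Rightarrow> real" where
  "noise n \<omega> = (\<lambda>i\<in>{..<n}. eps (Suc i) \<omega>)"

text \<open>It has \<open>n\<close> entries, so the states up to time n are
  \<open>trajectory (Suc n)\<close>, next to \<open>n\<close> environment values and
  \<open>n\<close> noise values.\<close>

definition trajectory :: "nat \<Rightarrow> 'w \<Rightarrow> nat \<Rightarrow> 'x" where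
  "trajectory n \<omega> = (\<lambda>i\<in>{0..<n}. X i \<omega>)"

lemma environment_measurable [measurable]: "environment n \<in> M \<rightarrow>\<^sub>M environments n"
  unfolding environment_def[abs_def] by measurable

lemma noise_measurable [measurable]: "noise n \<in> M \<rightarrow>\<^sub>M noises n"
  unfolding noise_def[abs_def] by measurable

lemma X_measurable [measurable]: "X k \<in> M \<rightarrow>\<^sub>M borel"
proof (induction k)
  case (Suc k)
  have "(\<lambda>\<omega>. f (X k \<omega>) (Y k \<omega>) (eps (Suc k) \<omega>)) \<in> M \<rightarrow>\<^sub>M borel"
    by (intro measurable_random_map Suc Y_measurable eps_measurable)
  then show ?case by (subst measurable_cong[OF X_step]) auto
qed (rule X_initial)

lemma trajectory_measurable [measurable]: "trajectory n \<in> M \<rightarrow>\<^sub>M paths n"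
  unfolding trajectory_def[abs_def] by measurable

lemma prob_space_initial_law: "prob_space initial_law"
  by (rule prob_space_distr) measurable

lemma initial_law_in_prob_algebra: "initial_law \<in> space (prob_algebra borel)"
  using prob_space_initial_law by (simp add: space_prob_algebra)

sublocale frozen: frozen_chain "param_kernel f" initial_law
  using param_kernel_measurable initial_law_in_prob_algebra by unfold_locales

lemma X_eq_env_path:
  assumes "\<omega> \<in> space M" "k \<le> n"
  shows "X k \<omega> = env_path f (environment n \<omega>) (X 0 \<omega>) (noise n \<omega>) k"
  using assms(2)
proof (induction k)
  case (Suc k)
  then show ?case using X_step[OF assms(1), of k] by (simp add: environment_def noise_def)
qed simp

text \<open>The product criterion for independence is applied on the index set
  \<open>{..<n}\<close>, which \<open>0 < n\<close> makes nonempty.\<close>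

lemma distr_noise:
  assumes "0 < n"
  shows "distr M (noises n) (noise n) = noises n"
proof -
  have "indep_vars (\<lambda>_. unit_uniform) (\<lambda>i. eps (Suc i)) {..<n}"
    by (rule indep_vars_subset[OF eps_indep]) simp
  then have "distr M (noises n) (noise n) = PiM {..<n} (\<lambda>i. distr M unit_uniform (eps (Suc i)))"
    using assms unfolding noise_def[abs_def]
    by (subst (asm) indep_vars_iff_distr_eq_PiM) auto
  then show ?thesis by (simp only: eps_uniform)
qed

text \<open>Independence of environment and noise splits the pair; independence of the start from
  the pair splits off the third factor.\<close>

lemma joint_law:
  assumes "0 < n"
  shows "distr M (borel \<Otimes>\<^sub>M (environments n \<Otimes>\<^sub>M noises n)) (\<lambda>\<omega>. (X 0 \<omega>, environment n \<omega>, noise n \<omega>)) =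
    initial_law \<Otimes>\<^sub>M (distr M (environments n) (environment n) \<Otimes>\<^sub>M noises n)"
proof -
  let ?EY = "PiM UNIV (\<lambda>_::nat. borel :: (real^'m) measure)" and ?EU = "PiM UNIV (\<lambda>_::nat. unit_uniform)"
  let ?Y = "\<lambda>\<omega> i. Y i \<omega>" and ?U = "\<lambda>\<omega> i. eps (Suc i) \<omega>"
  have m [measurable]: "?Y \<in> M \<rightarrow>\<^sub>M ?EY" "?U \<in> M \<rightarrow>\<^sub>M ?EU"
    using measurable_space[OF eps_measurable] by (auto intro!: measurable_PiM_single' simp: space_PiM)
  have r1 [measurable]: "(\<lambda>y. restrict y {..<n}) \<in> ?EY \<rightarrow>\<^sub>M environments n"
    by (rule measurable_restrict_subset) simp
  have r2 [measurable]: "(\<lambda>y. restrict y {..<n}) \<in> ?EU \<rightarrow>\<^sub>M noises n"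
    by (rule measurable_restrict_subset) simp
  \<comment> \<open>A truncation is measurable for the sigma-algebra generated by the whole sequence
    and so inherits its independence; \<open>mU\<close> and \<open>mYU\<close> serve the same
    purpose.\<close>
  have mY: "environment n \<in> vimage_algebra (space M) ?Y ?EY \<rightarrow>\<^sub>M environments n"
    using measurable_compose[OF measurable_vimage_algebra1 r1, of ?Y "space M"]
    by (simp add: environment_def[abs_def] restrict_def space_PiM)
  have mU: "noise n \<in> vimage_algebra (space M) ?U ?EU \<rightarrow>\<^sub>M noises n"
    using measurable_compose[OF measurable_vimage_algebra1 r2, of ?U "space M"] measurable_space[OF m(2)]
    by (simp add: noise_def[abs_def] restrict_def Pi_iff)
  have 1: "distr M (environments n) (environment n) \<Otimes>\<^sub>M distr M (noises n) (noise n) =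
      distr M (environments n \<Otimes>\<^sub>M noises n) (\<lambda>\<omega>. (environment n \<omega>, noise n \<omega>))"
    using measurable_sets[OF mY] measurable_sets[OF mU]
    by (intro distr_Pair_indep_set[OF eps_indep_environment]) simp_all
  let ?V = "vimage_algebra (space M) (\<lambda>\<omega>. (?Y \<omega>, ?U \<omega>)) (?EY \<Otimes>\<^sub>M ?EU)"
  have YU: "(\<lambda>\<omega>. (?Y \<omega>, ?U \<omega>)) \<in> ?V \<rightarrow>\<^sub>M ?EY \<Otimes>\<^sub>M ?EU"
    using measurable_space[OF measurable_Pair[OF m]] by (intro measurable_vimage_algebra1) auto
  have r: "(\<lambda>x. (restrict (fst x) {..<n}, restrict (snd x) {..<n}))
      \<in> ?EY \<Otimes>\<^sub>M ?EU \<rightarrow>\<^sub>M environments n \<Otimes>\<^sub>M noises n"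
    by (intro measurable_Pair measurable_compose[OF measurable_fst r1] measurable_compose[OF measurable_snd r2])
  have mYU: "(\<lambda>\<omega>. (environment n \<omega>, noise n \<omega>)) \<in> ?V \<rightarrow>\<^sub>M environments n \<Otimes>\<^sub>M noises n"
    using measurable_compose[OF YU r] by (simp add: environment_def[abs_def] noise_def[abs_def] restrict_def)
  have "initial_law \<Otimes>\<^sub>M distr M (environments n \<Otimes>\<^sub>M noises n) (\<lambda>\<omega>. (environment n \<omega>, noise n \<omega>)) =
      distr M (borel \<Otimes>\<^sub>M (environments n \<Otimes>\<^sub>M noises n)) (\<lambda>\<omega>. (X 0 \<omega>, environment n \<omega>, noise n \<omega>))"
    using measurable_sets[OF mYU]
    by (intro distr_Pair_indep_set[OF initial_indep]) (auto simp: in_vimage_algebra)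
  then show ?thesis
    unfolding 1[symmetric] distr_noise[OF assms] by simp
qed

lemma nn_integral_law:
  "h \<in> borel_measurable (paths (Suc n)) \<Longrightarrow> (\<integral>\<^sup>+x. h x \<partial>law n y) =
    (\<integral>\<^sup>+x. \<integral>\<^sup>+u. h (\<lambda>i\<in>{0..<Suc n}. env_path f y x u i) \<partial>noises n \<partial>initial_law)"
  by (rule frozen_law_param_kernel[OF initial_law_in_prob_algebra])

lemma frozen_path_measurable:
  "(\<lambda>(x, y, u). (y, \<lambda>i\<in>{0..<Suc n}. env_path f y x u i))
    \<in> borel \<Otimes>\<^sub>M (environments n \<Otimes>\<^sub>M noises n) \<rightarrow>\<^sub>M environments n \<Otimes>\<^sub>M paths (Suc n)"
  unfolding split_beta'
proof (intro measurable_Pair measurable_restrict measurable_env_path)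
  fix i k assume "k \<in> {0..<Suc n}" "i < k"
  then have "i \<in> {..<n}" by auto
  then show "(\<lambda>x. fst (snd x) i) \<in> borel \<Otimes>\<^sub>M (environments n \<Otimes>\<^sub>M noises n) \<rightarrow>\<^sub>M borel"
    "(\<lambda>x. snd (snd x) i) \<in> borel \<Otimes>\<^sub>M (environments n \<Otimes>\<^sub>M noises n) \<rightarrow>\<^sub>M unit_uniform"
    by measurable
qed measurable

text \<open>Through \<open>env_path\<close> the environment becomes an ordinary argument of a
  jointly measurable integrand, and measurability of parameter integrals applies twice.\<close>

lemma nn_integral_law_measurable:
  assumes "h \<in> borel_measurable (environments n \<Otimes>\<^sub>M paths (Suc n))"
  shows "(\<lambda>y. \<integral>\<^sup>+x. h (y, x) \<partial>law n y) \<in> borel_measurable (environments n)"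
proof -
  interpret I: prob_space initial_law by (rule prob_space_initial_law)
  interpret N: prob_space "noises n" by (rule prob_space_PiM) (rule prob_space_unit_uniform)
  let ?g = "\<lambda>(x, y, u). h (y, \<lambda>i\<in>{0..<Suc n}. env_path f y x u i)"
  have g: "?g \<in> borel_measurable (borel \<Otimes>\<^sub>M (environments n \<Otimes>\<^sub>M noises n))"
    using measurable_compose[OF frozen_path_measurable assms] by (simp only: split_beta')
  have "(\<lambda>z. (snd (fst z), fst (fst z), snd z)) \<in>
      (environments n \<Otimes>\<^sub>M initial_law) \<Otimes>\<^sub>M noises n \<rightarrow>\<^sub>M borel \<Otimes>\<^sub>M (environments n \<Otimes>\<^sub>M noises n)"
    by measurable
  from measurable_compose[OF this g]
  have "(\<lambda>(w, u). ?g (snd w, fst w, u)) \<in> borel_measurable ((environments n \<Otimes>\<^sub>M initial_law) \<Otimes>\<^sub>M noises n)"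
    by (simp only: split_beta' fst_conv snd_conv)
  from N.borel_measurable_nn_integral[OF this]
  have "(\<lambda>(y, x). \<integral>\<^sup>+u. ?g (x, y, u) \<partial>noises n) \<in> borel_measurable (environments n \<Otimes>\<^sub>M initial_law)"
    by (simp only: split_beta' fst_conv snd_conv)
  from I.borel_measurable_nn_integral[OF this]
  have "(\<lambda>y. \<integral>\<^sup>+x. \<integral>\<^sup>+u. ?g (x, y, u) \<partial>noises n \<partial>initial_law) \<in> borel_measurable (environments n)" .
  then show ?thesis
    by (subst measurable_cong[OF nn_integral_law]) (simp_all add: measurable_Pair2[OF assms])
qed

lemma disintegration:
  assumes n: "0 < n" and h: "h \<in> borel_measurable (environments n \<Otimes>\<^sub>M paths (Suc n))"
  shows "(\<integral>\<^sup>+\<omega>. h (environment n \<omega>, trajectory (Suc n) \<omega>) \<partial>M) =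
    (\<integral>\<^sup>+\<omega>. \<integral>\<^sup>+x. h (environment n \<omega>, x) \<partial>law n (environment n \<omega>) \<partial>M)"
proof -
  interpret I: prob_space initial_law by (rule prob_space_initial_law)
  interpret N: prob_space "noises n" by (rule prob_space_PiM) (rule prob_space_unit_uniform)
  let ?D = "distr M (environments n) (environment n)"
  interpret D: prob_space ?D by (rule prob_space_distr) measurable
  interpret DN: pair_prob_space ?D "noises n" ..
  interpret ID: pair_prob_space initial_law ?D ..
  let ?g = "\<lambda>(x, y, u). h (y, \<lambda>i\<in>{0..<Suc n}. env_path f y x u i)"
  have g: "?g \<in> borel_measurable (borel \<Otimes>\<^sub>M (environments n \<Otimes>\<^sub>M noises n))"
    using measurable_compose[OF frozen_path_measurable h] by (simp only: split_beta')
  have g': "?g \<in> borel_measurable (initial_law \<Otimes>\<^sub>M (?D \<Otimes>\<^sub>M noises n))"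
    using g by (subst measurable_cong_sets[OF sets_pair_measure_cong[OF _ sets_pair_measure_cong] refl]) auto
  have "(\<lambda>z. (fst (fst z), snd (fst z), snd z)) \<in>
      (initial_law \<Otimes>\<^sub>M ?D) \<Otimes>\<^sub>M noises n \<rightarrow>\<^sub>M initial_law \<Otimes>\<^sub>M (?D \<Otimes>\<^sub>M noises n)"
    by measurable
  from measurable_compose[OF this g']
  have "(\<lambda>(w, u). ?g (fst w, snd w, u)) \<in> borel_measurable ((initial_law \<Otimes>\<^sub>M ?D) \<Otimes>\<^sub>M noises n)"
    by (simp only: split_beta' fst_conv snd_conv)
  from N.borel_measurable_nn_integral[OF this]
  have inner: "(\<lambda>(x, y). \<integral>\<^sup>+u. ?g (x, y, u) \<partial>noises n) \<in> borel_measurable (initial_law \<Otimes>\<^sub>M ?D)"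
    by (simp only: split_beta' fst_conv snd_conv)
  have traj: "trajectory (Suc n) \<omega> = (\<lambda>i\<in>{0..<Suc n}. env_path f (environment n \<omega>) (X 0 \<omega>) (noise n \<omega>) i)"
    if "\<omega> \<in> space M" for \<omega>
    unfolding trajectory_def by (rule restrict_ext, rule X_eq_env_path[OF that]) simp
  have "(\<integral>\<^sup>+\<omega>. h (environment n \<omega>, trajectory (Suc n) \<omega>) \<partial>M) =
      (\<integral>\<^sup>+\<omega>. ?g (X 0 \<omega>, environment n \<omega>, noise n \<omega>) \<partial>M)"
    by (intro nn_integral_cong) (simp only: traj prod.case)
  also have "\<dots> = (\<integral>\<^sup>+w. ?g w \<partial>(initial_law \<Otimes>\<^sub>M (?D \<Otimes>\<^sub>M noises n)))"
    unfolding joint_law[OF n, symmetric] using g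
    by (intro nn_integral_distr[symmetric] measurable_Pair X_initial environment_measurable noise_measurable)
      simp
  also have "\<dots> = (\<integral>\<^sup>+x. \<integral>\<^sup>+w. ?g (x, w) \<partial>(?D \<Otimes>\<^sub>M noises n) \<partial>initial_law)"
    by (rule DN.nn_integral_fst[OF g', symmetric])
  also have "\<dots> = (\<integral>\<^sup>+x. \<integral>\<^sup>+y. \<integral>\<^sup>+u. ?g (x, y, u) \<partial>noises n \<partial>?D \<partial>initial_law)"
    by (intro nn_integral_cong N.nn_integral_fst[symmetric] measurable_Pair2[OF g'])
  \<comment> \<open>Start and environment are exchanged, so that the environment is integrated
    last.\<close>
  also have "\<dots> = (\<integral>\<^sup>+y. \<integral>\<^sup>+x. \<integral>\<^sup>+u. ?g (x, y, u) \<partial>noises n \<partial>initial_law \<partial>?D)"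
    by (rule ID.Fubini'[OF inner, symmetric])
  also have "\<dots> = (\<integral>\<^sup>+y. \<integral>\<^sup>+x. h (y, x) \<partial>law n y \<partial>?D)"
    by (intro nn_integral_cong, subst nn_integral_law) (auto intro: measurable_Pair2[OF h])
  also have "\<dots> = (\<integral>\<^sup>+\<omega>. \<integral>\<^sup>+x. h (environment n \<omega>, x) \<partial>law n (environment n \<omega>) \<partial>M)"
    using nn_integral_law_measurable[OF h] by (intro nn_integral_distr environment_measurable) simp
  finally show ?thesis .
qed

text \<open>Reconciles the truncated environment of the disintegration with the full sequence at
  which gradients are taken: \<open>env_path\<close> up to time n reads only the first n
  parameters.\<close>

lemma law_cong:
  assumes "\<And>i. i < n \<Longrightarrow> y i = y' i"
  shows "law n y = law n y'"
proof -
  have "emeasure (law n y) A = emeasure (law n y') A" if A: "A \<in> sets (PiM {0..<Suc n} (\<lambda>_. borel))" for A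
  proof -
    have "env_path f y x u i = env_path f y' x u i" if "i \<in> {0..<Suc n}" for x u i
      using that assms by (intro env_path_cong) auto
    then have "(\<lambda>i\<in>{0..<Suc n}. env_path f y x u i) = (\<lambda>i\<in>{0..<Suc n}. env_path f y' x u i)" for x u
      by (auto simp: fun_eq_iff)
    then show ?thesis
      using A nn_integral_law[OF borel_measurable_indicator[OF A], of y]
        nn_integral_law[OF borel_measurable_indicator[OF A], of y']
      by (simp add: frozen.sets_frozen_law)
  qed
  then show ?thesis by (intro measure_eqI) (auto simp: frozen.sets_frozen_law)
qed

lemma law_environment: "law n (environment n \<omega>) = law n (\<lambda>i. Y i \<omega>)"
  by (rule law_cong) (simp add: environment_def)

section \<open>Conditional expectations given the environment\<close>

lemma environment_algebra_eq:
  "environment_algebra M Y n = vimage_algebra (space M) (environment n) (environments n)"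
  by (simp add: environment_algebra_def environment_def[abs_def])

lemma sigma_finite_environment_algebra: "sigma_finite_subalgebra M (environment_algebra M Y n)"
proof -
  have "subalgebra M (environment_algebra M Y n)"
    unfolding subalgebra_def environment_algebra_eq
    using sets_image_in_sets[OF refl environment_measurable[of n]] by simp
  then have "finite_measure_subalgebra M (environment_algebra M Y n)"
    by (intro finite_measure_subalgebra.intro finite_measure_subalgebra_axioms.intro finite_measure_axioms)
  then show ?thesis by (rule finite_measure_subalgebra_is_sigma_finite)
qed

text \<open>The events of the environment algebra are preimages of measurable sets of environments,
  and restricting to one is absorbed into the integrand of the disintegration.\<close>

lemma AE_nn_cond_exp_environment:
  assumes n: "0 < n" and h: "h \<in> borel_measurable (environments n \<Otimes>\<^sub>M paths (Suc n))"
  shows "AE \<omega> in M. (\<integral>\<^sup>+x. h (environment n \<omega>, x) \<partial>law n (environment n \<omega>)) =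
    nn_cond_exp M (environment_algebra M Y n) (\<lambda>\<omega>. h (environment n \<omega>, trajectory (Suc n) \<omega>)) \<omega>"
proof -
  interpret sigma_finite_subalgebra M "environment_algebra M Y n"
    by (rule sigma_finite_environment_algebra)
  show ?thesis
  proof (rule nn_cond_exp_charact)
    show "(\<lambda>\<omega>. h (environment n \<omega>, trajectory (Suc n) \<omega>)) \<in> borel_measurable M"
      by (rule measurable_compose[OF _ h]) measurable
    have "environment n \<in> environment_algebra M Y n \<rightarrow>\<^sub>M environments n"
      unfolding environment_algebra_eq
      using measurable_space[OF environment_measurable[of n]] by (intro measurable_vimage_algebra1) auto
    from measurable_compose[OF this nn_integral_law_measurable[OF h]]
    show "(\<lambda>\<omega>. \<integral>\<^sup>+x. h (environment n \<omega>, x) \<partial>law n (environment n \<omega>)) \<in> borel_measurable (environment_algebra M Y n)" .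
  next
    fix A assume "A \<in> sets (environment_algebra M Y n)"
    then obtain B where B: "B \<in> sets (environments n)" and A: "A = environment n -` B \<inter> space M"
      unfolding environment_algebra_eq
      using measurable_space[OF environment_measurable[of n]] by (subst (asm) sets_vimage_algebra2) auto
    \<comment> \<open>The indicator depends on the environment alone, hence is constant in the inner
      integral over paths.\<close>
    let ?h = "\<lambda>w. h w * indicator B (fst w)"
    have h': "?h \<in> borel_measurable (environments n \<Otimes>\<^sub>M paths (Suc n))"
      using h measurable_compose[OF measurable_fst borel_measurable_indicator[OF B]]
      by (intro borel_measurable_times_ennreal)
    have "(\<integral>\<^sup>+\<omega>\<in>A. h (environment n \<omega>, trajectory (Suc n) \<omega>) \<partial>M) =
        (\<integral>\<^sup>+\<omega>. ?h (environment n \<omega>, trajectory (Suc n) \<omega>) \<partial>M)"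
      by (intro nn_integral_cong) (auto simp: A split: split_indicator)
    also have "\<dots> = (\<integral>\<^sup>+\<omega>. \<integral>\<^sup>+x. ?h (environment n \<omega>, x) \<partial>law n (environment n \<omega>) \<partial>M)"
      by (rule disintegration[OF n h'])
    also have "\<dots> = (\<integral>\<^sup>+\<omega>\<in>A. (\<integral>\<^sup>+x. h (environment n \<omega>, x) \<partial>law n (environment n \<omega>)) \<partial>M)"
      by (intro nn_integral_cong) (auto simp: A split: split_indicator)
    finally show "(\<integral>\<^sup>+\<omega>\<in>A. h (environment n \<omega>, trajectory (Suc n) \<omega>) \<partial>M) =
      (\<integral>\<^sup>+\<omega>\<in>A. (\<integral>\<^sup>+x. h (environment n \<omega>, x) \<partial>law n (environment n \<omega>)) \<partial>M)" .
  qed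
qed

text \<open>Both \<open>real_cond_exp\<close> and the integral under a frozen law are differences of
  positive and negative parts, so the nonnegative case is applied to each part; \<open>int\<close>
  gives the integral this form.\<close>

lemma AE_real_cond_exp_environment:
  fixes h :: "(nat \<Rightarrow> real^'m) \<times> (nat \<Rightarrow> 'x) \<Rightarrow> real"
  assumes n: "0 < n" and h: "h \<in> borel_measurable (environments n \<Otimes>\<^sub>M paths (Suc n))"
    and int: "\<And>y. integrable (law n y) (\<lambda>x. h (y, x))"
  shows "AE \<omega> in M. real_cond_exp M (environment_algebra M Y n) (\<lambda>\<omega>. h (environment n \<omega>, trajectory (Suc n) \<omega>)) \<omega> =
    (\<integral>x. h (environment n \<omega>, x) \<partial>law n (environment n \<omega>))"
proof -
  have "(\<lambda>w. ennreal (h w)) \<in> borel_measurable (environments n \<Otimes>\<^sub>M paths (Suc n))"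
    "(\<lambda>w. ennreal (- h w)) \<in> borel_measurable (environments n \<Otimes>\<^sub>M paths (Suc n))"
    using h by measurable
  from this[THEN AE_nn_cond_exp_environment[OF n]] show ?thesis
  proof eventually_elim
    case (elim \<omega>)
    then show ?case
      unfolding real_cond_exp_def real_lebesgue_integral_def[OF int] by simp
  qed
qed

end

theorem lemma2p10:
  fixes M :: "'w measure"
    and f :: "'x::polish_space \<Rightarrow> real^'m \<Rightarrow> real \<Rightarrow> 'x"
    and Y :: "nat \<Rightarrow> 'w \<Rightarrow> real^'m"
    and eps :: "nat \<Rightarrow> 'w \<Rightarrow> real"
    and X :: "nat \<Rightarrow> 'w \<Rightarrow> 'x"
    and \<nu> :: "'x measure"
    and \<pi> :: "'x \<Rightarrow> real"
    and p :: "real^'m \<Rightarrow> 'x \<Rightarrow> 'x \<Rightarrow> real"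
    and \<Phi> :: "'x \<Rightarrow> real"
    and n :: nat
  assumes chain: "random_environment_chain M f Y eps X"
    and Phi: "\<Phi> \<in> borel_measurable borel"
    and CR: "cramer_rao_regular \<nu> (param_kernel f) (distr M borel (X 0)) \<pi> p \<Phi>"
    and initial_indep:
      "prob_space.indep_set M
         (sets (vimage_algebra (space M) (X 0) borel))
         (sets (vimage_algebra (space M) (\<lambda>\<omega>. (\<lambda>i. Y i \<omega>, \<lambda>i. eps (Suc i) \<omega>))
           (PiM UNIV (\<lambda>_. borel) \<Otimes>\<^sub>M PiM UNIV (\<lambda>_. unit_uniform))))"
    and initial_abs_cont: "absolutely_continuous \<nu> (distr M borel (X 0))"
    and n: "1 \<le> n"
  shows "ext_variance M (\<lambda>\<omega>. \<Sum>k=1..n. \<Phi> (X k \<omega>)) \<ge>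
    (\<Sum>k<n. \<integral>\<^sup>+\<omega>. ennreal
       (1 / matrix_spectral_radius (cond_fisher M Y X p n k \<omega>) *
        (norm (gradient
           (\<lambda>v. frozen_mean_sum (param_kernel f) (distr M borel (X 0)) \<Phi> n ((\<lambda>i. Y i \<omega>)(k := v)))
           (Y k \<omega>)))\<^sup>2) \<partial>M)"
proof -
  interpret independent_start_chain M f Y eps X
    using chain initial_indep
    by (simp add: independent_start_chain_def independent_start_chain_axioms_def)
  interpret R: regular_chain \<nu> "param_kernel f" initial_law \<pi> p \<Phi>
    using CR initial_abs_cont Phi param_kernel_measurable initial_law_in_prob_algebra
    by (simp add: regular_chain_def regular_chain_axioms_def frozen_chain_def)
  define y where "y \<omega> = (\<lambda>i. Y i \<omega>)" for \<omega>
  define b where "b k \<omega> = R.mean_gradient n (y \<omega>) k" for k \<omega>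
  define c where "c = (\<integral>\<omega>. (\<Sum>k=1..n. \<Phi> (X k \<omega>)) \<partial>M)"
  have n0: "0 < n" using n by simp
  have law: "law n (environment n \<omega>) = law n (y \<omega>)" for \<omega>
    unfolding y_def by (rule law_environment)
  \<comment> \<open>Each matrix entry has its own exceptional null set; there are finitely many
    entries, so the matrices agree almost everywhere.\<close>
  have fisher: "AE \<omega> in M. cond_fisher M Y X p n k \<omega> = R.frozen_fisher n (y \<omega>) k" if k: "k < n" for k
  proof -
    let ?h = "\<lambda>i j w. transition_score p (fst w k) (snd w k) (snd w (Suc k)) $ i *
        transition_score p (fst w k) (snd w k) (snd w (Suc k)) $ j"
    have "AE \<omega> in M. cond_fisher M Y X p n k \<omega> $ i $ j = R.frozen_fisher n (y \<omega>) k $ i $ j" for i j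
    proof -
      have "(\<lambda>w. transition_score p (fst w k) (snd w k) (snd w (Suc k)))
          \<in> borel_measurable (environments n \<Otimes>\<^sub>M paths (Suc n))"
        using k by (intro R.measurable_transition_score) measurable
      then have h: "?h i j \<in> borel_measurable (environments n \<Otimes>\<^sub>M paths (Suc n))"
        by (intro borel_measurable_times borel_measurable_vec_nth)
      have "integrable (law n y') (\<lambda>x. ?h i j (y', x))" for y'
        using R.integrable_score_product[OF k k, of y' i j] by (simp add: R.score_def)
      from AE_real_cond_exp_environment[OF n0 h this]
      show ?thesis
      proof eventually_elim
        case (elim \<omega>)
        have "?h i j (environment n \<omega>, x) = R.score (y \<omega>) k x $ i * R.score (y \<omega>) k x $ j" for x
          using k by (simp add: environment_def R.score_def y_def)
        moreover have "?h i j (environment n \<omega>, trajectory (Suc n) \<omega>) =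
          transition_score p (Y k \<omega>) (X k \<omega>) (X (Suc k) \<omega>) $ i *
          transition_score p (Y k \<omega>) (X k \<omega>) (X (Suc k) \<omega>) $ j" for \<omega>
          using k by (simp add: environment_def trajectory_def)
        ultimately show ?case
          using elim by (simp add: cond_fisher_def R.frozen_fisher_def law)
      qed
    qed
    then have "AE \<omega> in M. \<forall>i j. cond_fisher M Y X p n k \<omega> $ i $ j = R.frozen_fisher n (y \<omega>) k $ i $ j"
      by (simp add: AE_all_countable)
    then show ?thesis by eventually_elim (simp add: vec_eq_iff)
  qed
  have "(\<Sum>k<n. \<integral>\<^sup>+\<omega>. ennreal (1 / matrix_spectral_radius (cond_fisher M Y X p n k \<omega>) * (norm (b k \<omega>))\<^sup>2) \<partial>M)
    = (\<Sum>k<n. \<integral>\<^sup>+\<omega>. ennreal (1 / matrix_spectral_radius (R.frozen_fisher n (y \<omega>) k) * (norm (b k \<omega>))\<^sup>2) \<partial>M)"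
  proof (intro sum.cong refl nn_integral_cong_AE)
    fix k assume "k \<in> {..<n}"
    with fisher[of k] show "AE \<omega> in M. ennreal (1 / matrix_spectral_radius (cond_fisher M Y X p n k \<omega>) * (norm (b k \<omega>))\<^sup>2) =
      ennreal (1 / matrix_spectral_radius (R.frozen_fisher n (y \<omega>) k) * (norm (b k \<omega>))\<^sup>2)"
      by (auto elim!: eventually_mono)
  qed
  \<comment> \<open>Superadditivity gives precisely the direction required for possibly
    nonmeasurable summands.\<close>
  also have "\<dots> \<le> (\<integral>\<^sup>+\<omega>. (\<Sum>k<n. ennreal (1 / matrix_spectral_radius (R.frozen_fisher n (y \<omega>) k) * (norm (b k \<omega>))\<^sup>2)) \<partial>M)"
    by (rule sum_nn_integral_le)
  also have "\<dots> \<le> (\<integral>\<^sup>+\<omega>. \<integral>\<^sup>+x. ennreal (((\<Sum>k=1..n. \<Phi> (x k)) - c)\<^sup>2) \<partial>law n (environment n \<omega>) \<partial>M)"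
  proof (rule nn_integral_mono)
    fix \<omega>
    \<comment> \<open>Nonnegative terms allow the sum of the \<open>ennreal\<close> values to be
      merged into the \<open>ennreal\<close> value of the sum.\<close>
    have "0 \<le> matrix_spectral_radius (R.frozen_fisher n (y \<omega>) k)" for k
      by (rule matrix_spectral_radius_symmetric(2)[OF R.transpose_frozen_fisher])
    then show "(\<Sum>k<n. ennreal (1 / matrix_spectral_radius (R.frozen_fisher n (y \<omega>) k) * (norm (b k \<omega>))\<^sup>2))
      \<le> (\<integral>\<^sup>+x. ennreal (((\<Sum>k=1..n. \<Phi> (x k)) - c)\<^sup>2) \<partial>law n (environment n \<omega>))"
      using R.frozen_cramer_rao[of n "y \<omega>" c] by (subst sum_ennreal) (simp_all add: law b_def)
  qed
  also have "\<dots> = (\<integral>\<^sup>+\<omega>. ennreal (((\<Sum>k=1..n. \<Phi> (trajectory (Suc n) \<omega> k)) - c)\<^sup>2) \<partial>M)"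
  proof -
    have "(\<lambda>x. \<Sum>k=1..n. \<Phi> (x k)) \<in> borel_measurable (paths (Suc n))"
      by (rule R.sum_Phi_paths)
    then have "(\<lambda>w. ennreal (((\<Sum>k=1..n. \<Phi> (snd w k)) - c)\<^sup>2)) \<in> borel_measurable (environments n \<Otimes>\<^sub>M paths (Suc n))"
      by measurable
    from disintegration[OF n0 this] show ?thesis by simp
  qed
  also have "\<dots> = ext_variance M (\<lambda>\<omega>. \<Sum>k=1..n. \<Phi> (X k \<omega>))"
    unfolding ext_variance_def c_def by (intro nn_integral_cong) (simp add: trajectory_def)
  finally show ?thesis
    unfolding b_def R.mean_gradient_def y_def .
qed

end
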